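(* Let $K$ be a transition kernel on $(G,\mathcal{B}(G))$ with stationary distribution $\pi$, let $\nu$ be a probability measure on $(G,\mathcal{B}(G))$, and consider the Markov chain with transition kernel $K$ and initial distribution $\nu$. Assume that $K$ is reversible with respect to $\pi$ and uniformly ergodic, i.e. there are $\alpha\in[0,1)$ and $M\in(0,\infty)$ such that for $\pi$-almost all $x\in G$ $$\|K^n(x,\cdot)-\pi\|_{\mathrm{tv}}\le \alpha^n M\qquad\text{for all } n\in\mathbb{N}.$$ Assume further that $\nu$ has a density $\frac{d\nu}{d\pi}$ with respect to $\pi$ with $\left\|\frac{d\nu}{d\pi}\right\|_\infty<\infty$. Let $p\in(1,2]$ and let $n_0\in\mathbb{N}_0$ satisfy $$n_0\ \ge\ \frac{\log\left(2M\left\|\frac{d\nu}{d\pi}-1\right\|_\infty\right)}{1-\alpha}.$$ Then for every $n\in\mathbb{N}$ and every $f\colon G\to\mathbb{R}$ with $\|f\|_p<\infty$, $$e_1(S_{n,n_0},f)\ \le\ \frac{4\|f\|_p}{(n\cdot \mathrm{gap}(P))^{1-1/p}}+\frac{4\|f\|_p}{(n\cdot(1-\alpha))^{2-2/p}}.$$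
   Context: $G$ is a metric space with Borel $\sigma$-algebra $\mathcal{B}(G)$, $\pi$ is a probability measure on it, $\mathbb{N}=\{1,2,\dots\}$, $\mathbb{N}_0=\{0,1,2,\dots\}$. For $p\in[1,\infty]$, $L_p=L_p(\pi)$ is the space of measurable $f\colon G\to\mathbb{R}$ with $\|f\|_p<\infty$, where $\|f\|_p=(\int_G|f|^p\,d\pi)^{1/p}$ for $p<\infty$ and $\|f\|_\infty$ is the $\pi$-essential supremum of $|f|$. $\mathbb{E}_\pi(f)=\int_G f\,d\pi$; $\mathbb{E}_\pi$ is also regarded as the operator mapping $f$ to the constant function $\mathbb{E}_\pi(f)$. $\pi$ is stationary for $K$: $\int_G K(x,A)\,d\pi(x)=\pi(A)$ for all $A\in\mathcal{B}(G)$. Reversible means $\int_A K(x,B)\,d\pi(x)=\int_B K(x,A)\,d\pi(x)$ for all $A,B\in\mathcal{B}(G)$. $K^n$ is the $n$-step transition kernel. The Markov operator is $Pf(x)=\int_G f(y)\,K(x,dy)$, and $\mathrm{gap}(P)=1-\|P-\mathbb{E}_\pi\|_{L_2\to L_2}$. The total variation distance is $\|\mu_1-\mu_2\|_{\mathrm{tv}}=\sup_{A\in\mathcal{B}(G)}|\mu_1(A)-\mu_2(A)|$. Indexing of the chain: $X_0\sim\nu$, so $X_j$ has distribution $\nu P^j$ for $j\in\mathbb{N}$, where $\nu P(A)=\int_G K(x,A)\,d\nu(x)$. For $n\in\mathbb{N}$, $n_0\in\mathbb{N}_0$, $$S_{n,n_0}(f)=\frac1n\sum_{j=1}^n f(X_{j+n_0}),\qquad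 e_1(S_{n,n_0},f)=\mathbb{E}\left|S_{n,n_0}(f)-\mathbb{E}_\pi(f)\right|,$$ the expectation being over the trajectory of the chain. Convention: $\log 0=-\infty$ (so if $\nu=\pi$ every $n_0\in\mathbb{N}_0$ is admissible). *)

theory Defs
  imports "HOL-Probability.Probability"
begin

definition Lp_space :: "'a measure \<Rightarrow> real \<Rightarrow> ('a \<Rightarrow> real) set" where
  "Lp_space \<mu> p = {f \<in> borel_measurable \<mu>. integrable \<mu> (\<lambda>x. \<bar>f x\<bar> powr p)}"

definition Lp_norm :: "'a measure \<Rightarrow> real \<Rightarrow> ('a \<Rightarrow> real) \<Rightarrow> real" where
  "Lp_norm \<mu> p f = (\<integral>x. \<bar>f x\<bar> powr p \<partial>\<mu>) powr (1 / p)"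

definition Linf_norm :: "'a measure \<Rightarrow> ('a \<Rightarrow> real) \<Rightarrow> ereal" where
  "Linf_norm \<mu> f = esssup \<mu> (\<lambda>x. ereal \<bar>f x\<bar>)"

text \<open>Operator norm on \<open>L\<^sub>2\<close>. The supremum is real-valued, so this is meaningful for
  operators that are bounded on \<open>L\<^sub>2\<close>. It is applied below only to \<open>P - E\<^sub>\<pi>\<close> with \<open>\<pi>\<close>
  stationary, which is such an operator because \<open>P\<close> is then a contraction on \<open>L\<^sub>2\<close>.\<close>
definition L2_opnorm :: "'a measure \<Rightarrow> (('a \<Rightarrow> real) \<Rightarrow> ('a \<Rightarrow> real)) \<Rightarrow> real" where
  "L2_opnorm \<mu> T = (SUP f\<in>{f \<in> Lp_space \<mu> 2. Lp_norm \<mu> 2 f \<le> 1}. Lp_norm \<mu> 2 (T f))"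

definition tv_dist :: "'a::topological_space measure \<Rightarrow> 'a measure \<Rightarrow> real" where
  "tv_dist \<mu>1 \<mu>2 = (SUP A\<in>sets borel. \<bar>measure \<mu>1 A - measure \<mu>2 A\<bar>)"

text \<open>A real-valued version of the Radon--Nikodym derivative \<open>d\<nu>/d\<mu>\<close>. For finite \<open>\<nu>\<close> with
  a density, \<open>RN_deriv \<mu> \<nu>\<close> is \<open>\<mu>\<close>-almost everywhere finite, so nothing is lost.\<close>
definition real_dens :: "'a measure \<Rightarrow> 'a measure \<Rightarrow> 'a \<Rightarrow> real" where
  "real_dens \<mu> \<nu> x = enn2real (RN_deriv \<mu> \<nu> x)"

definition transition_kernel :: "('a::topological_space \<Rightarrow> 'a measure) \<Rightarrow> bool" where
  "transition_kernel K \<longleftrightarrow> K \<in> borel \<rightarrow>\<^sub>M prob_algebra borel"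

primrec kernel_pow :: "('a::topological_space \<Rightarrow> 'a measure) \<Rightarrow> nat \<Rightarrow> 'a \<Rightarrow> 'a measure" where
  "kernel_pow K 0 x = return borel x"
| "kernel_pow K (Suc n) x = kernel_pow K n x \<bind> K"

definition stationary :: "('a::topological_space \<Rightarrow> 'a measure) \<Rightarrow> 'a measure \<Rightarrow> bool" where
  "stationary K \<pi> \<longleftrightarrow>
     (\<forall>A\<in>sets borel. (\<integral>\<^sup>+x. emeasure (K x) A \<partial>\<pi>) = emeasure \<pi> A)"

definition reversible :: "('a::topological_space \<Rightarrow> 'a measure) \<Rightarrow> 'a measure \<Rightarrow> bool" where
  "reversible K \<pi> \<longleftrightarrow>
     (\<forall>A\<in>sets borel. \<forall>B\<in>sets borel.
        (\<integral>\<^sup>+x\<in>A. emeasure (K x) B \<partial>\<pi>) = (\<integral>\<^sup>+x\<in>B. emeasure (K x) A \<partial>\<pi>))"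

text \<open>The quantifier over \<open>n\<close> is inside the almost-everywhere quantifier.\<close>
definition uniformly_ergodic ::
    "('a::topological_space \<Rightarrow> 'a measure) \<Rightarrow> 'a measure \<Rightarrow> real \<Rightarrow> real \<Rightarrow> bool" where
  "uniformly_ergodic K \<pi> \<alpha> M \<longleftrightarrow>
     0 \<le> \<alpha> \<and> \<alpha> < 1 \<and> 0 < M \<and>
     (AE x in \<pi>. \<forall>n\<ge>1. tv_dist (kernel_pow K n x) \<pi> \<le> \<alpha> ^ n * M)"

definition markov_op :: "('a \<Rightarrow> 'a measure) \<Rightarrow> ('a \<Rightarrow> real) \<Rightarrow> 'a \<Rightarrow> real" where
  "markov_op K f x = (\<integral>y. f y \<partial>K x)"

definition gap :: "('a \<Rightarrow> 'a measure) \<Rightarrow> 'a measure \<Rightarrow> real" where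
  "gap K \<pi> = 1 - L2_opnorm \<pi> (\<lambda>f x. markov_op K f x - (\<integral>y. f y \<partial>\<pi>))"

definition past_algebra :: "'w measure \<Rightarrow> (nat \<Rightarrow> 'w \<Rightarrow> 'a::topological_space) \<Rightarrow> nat \<Rightarrow> 'w measure"
  where
  "past_algebra \<Omega> X n =
     vimage_algebra (space \<Omega>) (\<lambda>\<omega>. \<lambda>i\<in>{..n}. X i \<omega>) (PiM {..n} (\<lambda>_. borel))"

text \<open>Markov property: \<open>P(X\<^sub>n\<^sub>+\<^sub>1 \<in> A | X\<^sub>0, \<dots>, X\<^sub>n) = K(X\<^sub>n, A)\<close> almost surely.\<close>
definition markov_chain ::
    "'w measure \<Rightarrow> (nat \<Rightarrow> 'w \<Rightarrow> 'a::topological_space) \<Rightarrow> ('a \<Rightarrow> 'a measure) \<Rightarrow> 'a measure \<Rightarrow> bool"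
  where
  "markov_chain \<Omega> X K \<nu> \<longleftrightarrow>
     prob_space \<Omega> \<and>
     (\<forall>n. X n \<in> \<Omega> \<rightarrow>\<^sub>M borel) \<and>
     distr \<Omega> borel (X 0) = \<nu> \<and>
     (\<forall>n. \<forall>A\<in>sets borel. AE \<omega> in \<Omega>.
        real_cond_exp \<Omega> (past_algebra \<Omega> X n) (\<lambda>\<omega>'. indicator A (X (Suc n) \<omega>')) \<omega>
          = measure (K (X n \<omega>)) A)"

definition avg :: "(nat \<Rightarrow> 'w \<Rightarrow> 'a) \<Rightarrow> nat \<Rightarrow> nat \<Rightarrow> ('a \<Rightarrow> real) \<Rightarrow> 'w \<Rightarrow> real" where
  "avg X n n0 f \<omega> = (1 / real n) * (\<Sum>j=1..n. f (X (j + n0) \<omega>))"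

text \<open>The mean absolute error is an extended nonnegative integral, so that a bound on it
  includes integrability of the error.\<close>
definition abs_error ::
    "'w measure \<Rightarrow> (nat \<Rightarrow> 'w \<Rightarrow> 'a) \<Rightarrow> 'a measure \<Rightarrow> nat \<Rightarrow> nat \<Rightarrow> ('a \<Rightarrow> real) \<Rightarrow> ennreal" where
  "abs_error \<Omega> X \<pi> n n0 f = (\<integral>\<^sup>+\<omega>. ennreal \<bar>avg X n n0 f \<omega> - (\<integral>x. f x \<partial>\<pi>)\<bar> \<partial>\<Omega>)"

end

theory Submission imports Defs begin

text \<open>
  Stationary case: a self-adjoint \<open>P\<close> that is uniformly ergodic contracts mean-zero functions
  by \<open>\<beta> = 1 - gap\<close> in \<open>L\<^sub>2\<close>, where \<open>\<beta> \<le> \<alpha> < 1\<close>: the sequence \<open>\<parallel>P\<^sup>n u\<parallel>\<^sub>2\<close> is log-convex and of order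
  \<open>\<alpha>\<^sup>n\<close> for bounded \<open>u\<close>. Reversibility makes \<open>P\<^sup>m (d\<nu>/d\<pi>)\<close> the density of the law of \<open>X\<^sub>m\<close>, and
  the lower bound on \<open>n\<^sub>0\<close> makes it at most \<open>2\<close> for \<open>m > n\<^sub>0\<close>. Hence, with \<open>N = n gap\<close>, the mean
  square error is at most \<open>4 \<parallel>u\<parallel>\<^sub>2\<^sup>2 / N\<close> for bounded \<open>u\<close>, and the mean absolute error is at most
  \<open>3 \<parallel>u\<parallel>\<^sub>1\<close> for every \<open>u\<close>. Instead of Riesz--Thorin interpolation between these two bounds, \<open>f\<close> is cut
  at height \<open>t\<close>, which gives \<open>t / N + 3 t\<^bsup>1 - p\<^esup> \<parallel>f\<parallel>\<^sub>p\<^sup>p\<close>; for \<open>t\<^sup>p = N \<parallel>f\<parallel>\<^sub>p\<^sup>p\<close> this is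
  exactly the first summand of the claimed bound.
\<close>

section \<open>Bounded Borel functions and the Cauchy-Schwarz inequality\<close>

text \<open>The bound holds at every point, not just \<open>\<pi>\<close>-almost everywhere, because
  such functions are integrated against single measures \<open>K x\<close>, which may charge
  \<open>\<pi>\<close>-null sets.\<close>

definition bounded_borel :: "real \<Rightarrow> ('a::topological_space \<Rightarrow> real) \<Rightarrow> bool" where
  "bounded_borel c u \<longleftrightarrow> u \<in> borel_measurable borel \<and> (\<forall>x. \<bar>u x\<bar> \<le> c)"

lemma bounded_borelD:
  assumes "bounded_borel c u"
  shows "u \<in> borel_measurable borel" "\<bar>u x\<bar> \<le> c"
  using assms by (auto simp: bounded_borel_def)

lemma bounded_borel_mult:
  "bounded_borel c u \<Longrightarrow> bounded_borel d v \<Longrightarrow> bounded_borel (c * d) (\<lambda>x. u x * v x)"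
  unfolding bounded_borel_def abs_mult
  by (fastforce intro!: mult_mono intro: order_trans[OF abs_ge_zero])

lemma bounded_borel_add_const:
  "bounded_borel c u \<Longrightarrow> bounded_borel (c + \<bar>d\<bar>) (\<lambda>x. u x + d)"
  unfolding bounded_borel_def by (fastforce intro: order_trans[OF abs_triangle_ineq])

lemma integrable_bounded_borel:
  assumes "finite_measure M" and "sets M = sets borel" and "bounded_borel c u"
  shows "integrable M u"
proof (rule finite_measure.integrable_const_bound[OF assms(1), of _ c])
  show "u \<in> borel_measurable M"
    using assms by (simp add: bounded_borel_def cong: measurable_cong_sets)
qed (use assms in \<open>auto simp: bounded_borel_def\<close>)

lemma (in finite_measure) integrable_bounded_borel_comp:
  assumes "Y \<in> M \<rightarrow>\<^sub>M borel" and "bounded_borel c u"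
  shows "integrable M (\<lambda>\<omega>. u (Y \<omega>))"
proof (rule integrable_const_bound[of _ c])
  show "(\<lambda>\<omega>. u (Y \<omega>)) \<in> borel_measurable M"
    using assms by (auto simp: bounded_borel_def)
qed (use assms in \<open>auto simp: bounded_borel_def\<close>)

text \<open>The absolute value stays inside the integral because correlations are later integrated
  against a density of which only an upper bound is known. The inequality comes from its extended
  nonnegative version; integrability makes all three integrals real.\<close>

lemma Cauchy_Schwarz_integral:
  fixes u v :: "'a \<Rightarrow> real"
  assumes [measurable]: "u \<in> borel_measurable M" "v \<in> borel_measurable M"
    and "integrable M (\<lambda>x. (u x)\<^sup>2)" "integrable M (\<lambda>x. (v x)\<^sup>2)"
    and "integrable M (\<lambda>x. u x * v x)"
  shows "(\<integral>x. \<bar>u x * v x\<bar> \<partial>M)\<^sup>2 \<le> (\<integral>x. (u x)\<^sup>2 \<partial>M) * (\<integral>x. (v x)\<^sup>2 \<partial>M)"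
proof -
  have "(\<integral>\<^sup>+x. ennreal \<bar>u x\<bar> * ennreal \<bar>v x\<bar> \<partial>M)\<^sup>2
      \<le> (\<integral>\<^sup>+x. ennreal \<bar>u x\<bar> ^ 2 \<partial>M) * (\<integral>\<^sup>+x. ennreal \<bar>v x\<bar> ^ 2 \<partial>M)"
    by (rule Cauchy_Schwarz_nn_integral) auto
  then have "(\<integral>\<^sup>+x. ennreal \<bar>u x * v x\<bar> \<partial>M)\<^sup>2
      \<le> (\<integral>\<^sup>+x. ennreal ((u x)\<^sup>2) \<partial>M) * (\<integral>\<^sup>+x. ennreal ((v x)\<^sup>2) \<partial>M)"
    by (simp add: abs_mult ennreal_mult ennreal_power)
  then have "ennreal (\<integral>x. \<bar>u x * v x\<bar> \<partial>M) ^ 2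
      \<le> ennreal (\<integral>x. (u x)\<^sup>2 \<partial>M) * ennreal (\<integral>x. (v x)\<^sup>2 \<partial>M)"
    using assms by (simp add: nn_integral_eq_integral)
  then show ?thesis
    by (simp add: ennreal_power flip: ennreal_mult)
qed

section \<open>Reversible kernels\<close>

locale kernel =
  fixes K :: "'a::metric_space \<Rightarrow> 'a measure"
  assumes kernel: "transition_kernel K"
begin

lemma kernel_prob_algebra [measurable]: "K \<in> borel \<rightarrow>\<^sub>M prob_algebra borel"
  using kernel by (simp add: transition_kernel_def)

lemma kernel_subprob_algebra [measurable]: "K \<in> borel \<rightarrow>\<^sub>M subprob_algebra borel"
  by (rule measurable_prob_algebraD[OF kernel_prob_algebra])

lemma prob_space_kernel: "prob_space (K x)"
  using measurable_space[OF kernel_prob_algebra, of x] by (simp add: space_prob_algebra)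

lemma sets_kernel [measurable_cong]: "sets (K x) = sets borel"
  using measurable_space[OF kernel_prob_algebra, of x] by (simp add: space_prob_algebra)

lemma markov_op_measurable [measurable]:
  "u \<in> borel_measurable borel \<Longrightarrow> markov_op K u \<in> borel_measurable borel"
  unfolding markov_op_def
  by (rule measurable_compose[OF kernel_subprob_algebra integral_measurable_subprob_algebra])

lemma integrable_kernel: "bounded_borel c u \<Longrightarrow> integrable (K x) u"
  using integrable_bounded_borel[OF prob_space.finite_measure[OF prob_space_kernel] sets_kernel] .

lemma abs_integral_bounded_borel:
  assumes "prob_space N" "sets N = sets borel" "bounded_borel c u"
  shows "\<bar>\<integral>y. u y \<partial>N\<bar> \<le> c"
proof -
  interpret prob_space N by fact
  have "\<bar>\<integral>y. u y \<partial>N\<bar> \<le> (\<integral>y. \<bar>u y\<bar> \<partial>N)"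
    by (rule integral_abs_bound)
  also have "\<dots> \<le> (\<integral>y. c \<partial>N)"
    using assms integrable_bounded_borel[OF finite_measure_axioms assms(2,3)]
    by (intro integral_mono) (auto simp: bounded_borel_def)
  finally show ?thesis by (simp add: prob_space)
qed

lemma bounded_borel_markov_op:
  "bounded_borel c u \<Longrightarrow> bounded_borel c (markov_op K u)"
  using abs_integral_bounded_borel[OF prob_space_kernel sets_kernel]
  by (auto simp: bounded_borel_def markov_op_def[symmetric])

lemma bounded_borel_markov_op_pow:
  "bounded_borel c u \<Longrightarrow> bounded_borel c ((markov_op K ^^ n) u)"
  by (induction n) (auto intro: bounded_borel_markov_op)

lemma markov_op_add_const:
  assumes "bounded_borel c u"
  shows "markov_op K (\<lambda>y. u y + d) x = markov_op K u x + d"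
  using integrable_kernel[OF assms] prob_space.prob_space[OF prob_space_kernel, of x]
  using prob_space.finite_measure[OF prob_space_kernel, of x]
  by (simp add: markov_op_def finite_measure.integrable_const)

lemma markov_op_pow_add_const:
  assumes "bounded_borel c u"
  shows "(markov_op K ^^ n) (\<lambda>y. u y + d) = (\<lambda>x. (markov_op K ^^ n) u x + d)"
proof (induction n)
  case (Suc n)
  then show ?case
    using markov_op_add_const[OF bounded_borel_markov_op_pow[OF assms]] by auto
qed simp

lemma markov_op_nonneg:
  "(\<And>y. 0 \<le> u y) \<Longrightarrow> 0 \<le> markov_op K u x"
  by (simp add: markov_op_def)

lemma markov_op_pow_nonneg:
  "(\<And>y. 0 \<le> u y) \<Longrightarrow> 0 \<le> (markov_op K ^^ n) u x"
  by (induction n arbitrary: x) (auto intro: markov_op_nonneg)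

lemma nn_integral_kernel:
  assumes "bounded_borel c u" "\<And>y. 0 \<le> u y"
  shows "(\<integral>\<^sup>+y. ennreal (u y) \<partial>K x) = ennreal (markov_op K u x)"
  unfolding markov_op_def using assms
  by (intro nn_integral_eq_integral integrable_kernel) auto

lemma integral_bind_kernel:
  assumes "finite_measure N" "sets N = sets borel" "bounded_borel c u"
  shows "(\<integral>y. u y \<partial>(N \<bind> K)) = (\<integral>x. markov_op K u x \<partial>N)"
  unfolding markov_op_def
proof (rule integral_bind[where K = borel and B = c and B' = 1])
  show "K \<in> N \<rightarrow>\<^sub>M subprob_algebra borel"
    using kernel_subprob_algebra assms(2) by (simp cong: measurable_cong_sets)
qed (use assms in \<open>auto simp: bounded_borel_def prob_space.emeasure_space_1[OF prob_space_kernel]\<close>)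

lemma emeasure_bind_kernel:
  assumes "sets N = sets borel" "A \<in> sets borel"
  shows "emeasure (N \<bind> K) A = (\<integral>\<^sup>+x. emeasure (K x) A \<partial>N)"
proof (rule emeasure_bind)
  show "space N \<noteq> {}" using sets_eq_imp_space_eq[OF assms(1)] by simp
  show "K \<in> N \<rightarrow>\<^sub>M subprob_algebra borel"
    using kernel_subprob_algebra assms(1) by (simp cong: measurable_cong_sets)
qed fact

lemma sets_bind_kernel:
  assumes "sets N = sets borel"
  shows "sets (N \<bind> K) = sets borel"
  using sets_eq_imp_space_eq[OF assms] by (intro sets_bind) (auto simp: sets_kernel)

lemma nn_integral_bind_kernel:
  assumes "sets N = sets borel" "u \<in> borel_measurable borel"
  shows "(\<integral>\<^sup>+y. u y \<partial>(N \<bind> K)) = (\<integral>\<^sup>+x. \<integral>\<^sup>+y. u y \<partial>K x \<partial>N)"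
proof (rule nn_integral_bind)
  show "K \<in> N \<rightarrow>\<^sub>M subprob_algebra borel"
    using kernel_subprob_algebra assms(1) by (simp cong: measurable_cong_sets)
qed (use assms in auto)

end

locale reversible_kernel = kernel K + prob_space \<pi>
  for K :: "'a::metric_space \<Rightarrow> 'a measure" and \<pi> :: "'a measure" +
  assumes sets_pi [measurable_cong]: "sets \<pi> = sets borel"
    and reversible: "reversible K \<pi>"
begin

abbreviation P :: "('a \<Rightarrow> real) \<Rightarrow> 'a \<Rightarrow> real" where "P \<equiv> markov_op K"

lemma measurable_pi: "u \<in> borel_measurable borel \<Longrightarrow> u \<in> borel_measurable \<pi>"
  using sets_pi by (simp cong: measurable_cong_sets)

lemma integrable_pi: "bounded_borel c u \<Longrightarrow> integrable \<pi> u"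
  by (rule integrable_bounded_borel[OF finite_measure_axioms sets_pi])

text \<open>Evaluated at \<open>B\<close>, the two sides are exactly the two sides of the
  reversibility condition.\<close>

lemma bind_kernel_density_indicator:
  assumes A [measurable]: "A \<in> sets borel"
  shows "density \<pi> (indicator A) \<bind> K = density \<pi> (\<lambda>x. emeasure (K x) A)"
proof (rule measure_eqI)
  show "sets (density \<pi> (indicator A) \<bind> K) = sets (density \<pi> (\<lambda>x. emeasure (K x) A))"
    by (simp add: sets_bind_kernel sets_pi)
next
  fix B assume "B \<in> sets (density \<pi> (indicator A) \<bind> K)"
  then have [measurable]: "B \<in> sets borel"
    by (simp add: sets_bind_kernel sets_pi)
  have "emeasure (density \<pi> (indicator A) \<bind> K) B = (\<integral>\<^sup>+x\<in>A. emeasure (K x) B \<partial>\<pi>)"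
    by (simp add: emeasure_bind_kernel sets_pi nn_integral_density mult.commute)
  also have "\<dots> = (\<integral>\<^sup>+x\<in>B. emeasure (K x) A \<partial>\<pi>)"
    using reversible by (simp add: reversible_def)
  also have "\<dots> = emeasure (density \<pi> (\<lambda>x. emeasure (K x) A)) B"
    by (simp add: emeasure_density sets_pi)
  finally show "emeasure (density \<pi> (indicator A) \<bind> K) B
      = emeasure (density \<pi> (\<lambda>x. emeasure (K x) A)) B" .
qed

text \<open>This is the form in which reversibility is used: one step of the chain acts on densities
  by the same operator \<open>P\<close> that acts on functions. It extends the indicator case by
  exchanging the roles of weight and integrand.\<close>

lemma bind_kernel_density:
  assumes q: "bounded_borel c q" "\<And>x. 0 \<le> q x"
  shows "density \<pi> (\<lambda>x. ennreal (q x)) \<bind> K = density \<pi> (\<lambda>x. ennreal (P q x))"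
proof (rule measure_eqI)
  show "sets (density \<pi> (\<lambda>x. ennreal (q x)) \<bind> K) = sets (density \<pi> (\<lambda>x. ennreal (P q x)))"
    by (simp add: sets_bind_kernel sets_pi)
next
  have [measurable]: "q \<in> borel_measurable borel" by (rule bounded_borelD[OF q(1)])
  fix A assume "A \<in> sets (density \<pi> (\<lambda>x. ennreal (q x)) \<bind> K)"
  then have [measurable]: "A \<in> sets borel"
    by (simp add: sets_bind_kernel sets_pi)
  have "emeasure (density \<pi> (\<lambda>x. ennreal (q x)) \<bind> K) A
      = (\<integral>\<^sup>+x. emeasure (K x) A * ennreal (q x) \<partial>\<pi>)"
    by (simp add: emeasure_bind_kernel sets_pi nn_integral_density mult.commute)
  \<comment> \<open>Now \<open>x \<mapsto> K x A\<close> is the weight and \<open>q\<close> the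
    integrand, so the indicator case applies to the weight and the step of the chain falls on
    \<open>q\<close>.\<close>
  also have "\<dots> = (\<integral>\<^sup>+x. ennreal (q x) \<partial>density \<pi> (\<lambda>x. emeasure (K x) A))"
    by (simp add: nn_integral_density)
  also have "\<dots> = (\<integral>\<^sup>+x. ennreal (q x) \<partial>(density \<pi> (indicator A) \<bind> K))"
    by (simp add: bind_kernel_density_indicator)
  also have "\<dots> = (\<integral>\<^sup>+x. ennreal (P q x) \<partial>density \<pi> (indicator A))"
    by (simp add: nn_integral_bind_kernel sets_pi nn_integral_kernel[OF q])
  also have "\<dots> = emeasure (density \<pi> (\<lambda>x. ennreal (P q x))) A"
    by (simp add: nn_integral_density emeasure_density sets_pi mult.commute)
  finally show "emeasure (density \<pi> (\<lambda>x. ennreal (q x)) \<bind> K) A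
      = emeasure (density \<pi> (\<lambda>x. ennreal (P q x))) A" .
qed

text \<open>The density 1 is fixed by \<open>P\<close>, since every \<open>K x\<close> has mass
  1.\<close>

lemma bind_kernel_pi: "\<pi> \<bind> K = \<pi>"
proof -
  have "bounded_borel 1 (\<lambda>_::'a. 1::real)" by (simp add: bounded_borel_def)
  from bind_kernel_density[OF this] show ?thesis
    by (simp add: markov_op_def prob_space.prob_space[OF prob_space_kernel] density_1)
qed

lemma integral_markov_op: "bounded_borel c u \<Longrightarrow> (\<integral>x. P u x \<partial>\<pi>) = (\<integral>x. u x \<partial>\<pi>)"
  using integral_bind_kernel[OF _ sets_pi, of c u] bind_kernel_pi
  by (simp add: finite_measure_axioms)

lemma integral_markov_op_pow:
  "bounded_borel c u \<Longrightarrow> (\<integral>x. (P ^^ n) u x \<partial>\<pi>) = (\<integral>x. u x \<partial>\<pi>)"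
  by (induction n) (auto simp: integral_markov_op[OF bounded_borel_markov_op_pow])

text \<open>A nonnegative \<open>v\<close> can be read as a density: both sides integrate
  \<open>u\<close> against the law reached in one step from \<open>density \<pi> v\<close>.\<close>

lemma self_adjoint_nonneg:
  assumes u: "bounded_borel c u" and v: "bounded_borel d v" "\<And>x. 0 \<le> v x"
  shows "(\<integral>x. u x * P v x \<partial>\<pi>) = (\<integral>x. P u x * v x \<partial>\<pi>)"
proof -
  have [measurable]: "u \<in> borel_measurable borel" "v \<in> borel_measurable borel"
    using bounded_borelD(1)[OF u] bounded_borelD(1)[OF v(1)] by auto
  have fin: "finite_measure (density \<pi> (\<lambda>x. ennreal (v x)))"
    using integrable_pi[OF v(1)] v(2)
    by (intro finite_measureI) (simp add: emeasure_density nn_integral_eq_integral cong: nn_integral_cong)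
  have "(\<integral>x. u x * P v x \<partial>\<pi>) = (\<integral>x. u x \<partial>density \<pi> (\<lambda>x. ennreal (P v x)))"
    using markov_op_nonneg[OF v(2)] by (simp add: integral_density mult.commute)
  also have "\<dots> = (\<integral>x. P u x \<partial>density \<pi> (\<lambda>x. ennreal (v x)))"
    using integral_bind_kernel[OF fin _ u] bind_kernel_density[OF v] by (simp add: sets_pi)
  also have "\<dots> = (\<integral>x. P u x * v x \<partial>\<pi>)"
    using v(2) by (simp add: integral_density mult.commute)
  finally show ?thesis .
qed

lemma self_adjoint:
  assumes u: "bounded_borel c u" and v: "bounded_borel d v"
  shows "(\<integral>x. u x * P v x \<partial>\<pi>) = (\<integral>x. P u x * v x \<partial>\<pi>)"
proof -
  \<comment> \<open>Shifting by \<open>d\<close> makes \<open>v\<close> nonnegative; the extra terms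
    \<open>u x * d\<close> and \<open>P u x * d\<close> have the same integral by invariance and
    cancel.\<close>
  have "0 \<le> v x + d" for x
    using bounded_borelD(2)[OF v, of x] by auto
  from self_adjoint_nonneg[OF u bounded_borel_add_const[OF v] this]
  have "(\<integral>x. u x * P v x + u x * d \<partial>\<pi>) = (\<integral>x. P u x * v x + P u x * d \<partial>\<pi>)"
    by (simp add: markov_op_add_const[OF v] distrib_left)
  moreover have "integrable \<pi> (\<lambda>x. u x * P v x)" "integrable \<pi> (\<lambda>x. P u x * v x)"
    "integrable \<pi> u" "integrable \<pi> (P u)"
    using integrable_pi bounded_borel_mult bounded_borel_markov_op u v by blast+
  ultimately show ?thesis
    using integral_markov_op[OF u] by simp
qed

end

section \<open>Uniform ergodicity and the spectral gap\<close>

lemma tv_dist_measure_le: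
  assumes "prob_space \<mu>1" "prob_space \<mu>2" "A \<in> sets borel"
  shows "measure \<mu>1 A \<le> measure \<mu>2 A + tv_dist \<mu>1 \<mu>2"
proof -
  have "\<bar>measure \<mu>1 A - measure \<mu>2 A\<bar> \<le> tv_dist \<mu>1 \<mu>2"
    unfolding tv_dist_def
  proof (rule cSUP_upper)
    \<comment> \<open>The supremum is real-valued, so it dominates its members only once the family
      is known to be bounded.\<close>
    have "\<bar>measure \<mu>1 B - measure \<mu>2 B\<bar> \<le> 1" for B
      using prob_space.prob_le_1[OF assms(1), of B] prob_space.prob_le_1[OF assms(2), of B]
        measure_nonneg[of \<mu>1 B] measure_nonneg[of \<mu>2 B] by linarith
    then show "bdd_above ((\<lambda>A. \<bar>measure \<mu>1 A - measure \<mu>2 A\<bar>) ` sets borel)"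
      by (auto intro!: bdd_aboveI[of _ 1])
  qed fact
  then show ?thesis by linarith
qed

lemma tv_dist_nonneg:
  assumes "prob_space \<mu>1" "prob_space \<mu>2"
  shows "0 \<le> tv_dist \<mu>1 \<mu>2"
  using tv_dist_measure_le[OF assms, of "{}"] by simp

lemma tv_dist_commute: "tv_dist \<mu>1 \<mu>2 = tv_dist \<mu>2 \<mu>1"
  by (simp add: tv_dist_def abs_minus_commute)

text \<open>Fubini for the region below the graph of \<open>w\<close>. It reduces integrals to
  measures of sets, the only quantities that the total variation distance compares directly.\<close>

lemma nn_integral_layer_cake:
  fixes w :: "'a::topological_space \<Rightarrow> real"
  assumes "finite_measure N" "sets N = sets borel" "w \<in> borel_measurable borel"
    and w: "\<And>x. 0 \<le> w x" "\<And>x. w x \<le> L"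
  shows "(\<integral>\<^sup>+x. ennreal (w x) \<partial>N) = (\<integral>\<^sup>+t\<in>{0..L}. emeasure N {x. t \<le> w x} \<partial>lborel)"
proof -
  interpret N: finite_measure N by fact
  interpret pair_sigma_finite N lborel ..
  note assms(2) [measurable_cong] assms(3) [measurable]
  have "(\<integral>\<^sup>+x. ennreal (w x) \<partial>N) = (\<integral>\<^sup>+x. \<integral>\<^sup>+t. indicator {0..L} t * indicator {x. t \<le> w x} x \<partial>lborel \<partial>N)"
  proof (rule nn_integral_cong)
    fix x
    have "(\<integral>\<^sup>+t. indicator {0..L} t * indicator {x. t \<le> w x} x \<partial>lborel)
        = (\<integral>\<^sup>+t. indicator {0..w x} t \<partial>lborel)"
      using w(2)[of x] by (intro nn_integral_cong) (auto simp: indicator_def)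
    then show "ennreal (w x) = (\<integral>\<^sup>+t. indicator {0..L} t * indicator {x. t \<le> w x} x \<partial>lborel)"
      using w(1) by simp
  qed
  also have "\<dots> = (\<integral>\<^sup>+t. \<integral>\<^sup>+x. indicator {0..L} t * indicator {x. t \<le> w x} x \<partial>N \<partial>lborel)"
    by (rule Fubini'[symmetric]) (simp add: indicator_def)
  also have "\<dots> = (\<integral>\<^sup>+t\<in>{0..L}. emeasure N {x. t \<le> w x} \<partial>lborel)"
    by (intro nn_integral_cong) (simp add: nn_integral_cmult assms(2) mult.commute)
  finally show ?thesis .
qed

text \<open>The shift \<open>w = u + c\<close> takes values in \<open>{0..2 * c}\<close>. The
  measures of each level set of \<open>w\<close> differ by at most the total variation distance, and
  the levels range over an interval of length \<open>2 * c\<close>.\<close>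

lemma integral_le_tv_dist:
  assumes p1: "prob_space \<mu>1" and s1: "sets \<mu>1 = sets borel"
    and p2: "prob_space \<mu>2" and s2: "sets \<mu>2 = sets borel"
    and u: "bounded_borel c u"
  shows "(\<integral>x. u x \<partial>\<mu>1) \<le> (\<integral>x. u x \<partial>\<mu>2) + 2 * c * tv_dist \<mu>1 \<mu>2"
proof -
  interpret p1: prob_space \<mu>1 by fact
  interpret p2: prob_space \<mu>2 by fact
  note [measurable] = bounded_borelD(1)[OF u]
  define w where "w x = u x + c" for x
  have [measurable]: "w \<in> borel_measurable borel" by (simp add: w_def[abs_def])
  have w: "0 \<le> w x" "w x \<le> 2 * c" for x
    using bounded_borelD(2)[OF u, of x] by (auto simp: w_def)
  have c: "0 \<le> c" using w[of undefined] by linarith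
  have i: "integrable \<mu>1 u" "integrable \<mu>2 u"
    using integrable_bounded_borel[OF p1.finite_measure_axioms s1 u]
      integrable_bounded_borel[OF p2.finite_measure_axioms s2 u] by auto
  have e: "(\<integral>\<^sup>+x. ennreal (w x) \<partial>\<mu>1) = ennreal ((\<integral>x. u x \<partial>\<mu>1) + c)"
      "(\<integral>\<^sup>+x. ennreal (w x) \<partial>\<mu>2) = ennreal ((\<integral>x. u x \<partial>\<mu>2) + c)"
    using i w by (auto simp: nn_integral_eq_integral w_def p1.prob_space p2.prob_space)
  have nn: "0 \<le> (\<integral>x. u x \<partial>\<mu>2) + c"
    using integral_nonneg_AE[of w \<mu>2] w i by (simp add: w_def[abs_def] p2.prob_space)
  have "(\<integral>\<^sup>+x. ennreal (w x) \<partial>\<mu>1) = (\<integral>\<^sup>+t\<in>{0..2 * c}. emeasure \<mu>1 {x. t \<le> w x} \<partial>lborel)"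
    by (rule nn_integral_layer_cake[OF p1.finite_measure_axioms s1]) (use w in auto)
  also have "\<dots> \<le> (\<integral>\<^sup>+t\<in>{0..2 * c}. (emeasure \<mu>2 {x. t \<le> w x} + ennreal (tv_dist \<mu>1 \<mu>2)) \<partial>lborel)"
  proof (intro nn_integral_mono mult_right_mono)
    fix t
    have "measure \<mu>1 {x. t \<le> w x} \<le> measure \<mu>2 {x. t \<le> w x} + tv_dist \<mu>1 \<mu>2"
      by (rule tv_dist_measure_le[OF p1 p2]) auto
    then show "emeasure \<mu>1 {x. t \<le> w x} \<le> emeasure \<mu>2 {x. t \<le> w x} + ennreal (tv_dist \<mu>1 \<mu>2)"
      by (simp add: p1.emeasure_eq_measure p2.emeasure_eq_measure tv_dist_nonneg[OF p1 p2]
          flip: ennreal_plus)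
  qed simp
  also have "\<dots> = (\<integral>\<^sup>+t\<in>{0..2 * c}. emeasure \<mu>2 {x. t \<le> w x} \<partial>lborel)
      + (\<integral>\<^sup>+t\<in>{0..2 * c}. ennreal (tv_dist \<mu>1 \<mu>2) \<partial>lborel)"
    unfolding distrib_right
  proof (rule nn_integral_add)
    note s2 [measurable_cong]
    \<comment> \<open>The level sets are sections of one measurable set in the product, which makes
      their measure a measurable function of the level.\<close>
    have "(\<lambda>t. emeasure \<mu>2 (Pair t -` {y \<in> space (lborel \<Otimes>\<^sub>M \<mu>2). fst y \<le> w (snd y)})) \<in> borel_measurable lborel"
      by (rule p2.measurable_emeasure_Pair) measurable
    then show "(\<lambda>t. emeasure \<mu>2 {x. t \<le> w x} * indicator {0..2 * c} t) \<in> borel_measurable lborel"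
      using sets_eq_imp_space_eq[OF s2] by (simp add: space_pair_measure vimage_def)
  qed simp
  also have "(\<integral>\<^sup>+t\<in>{0..2 * c}. emeasure \<mu>2 {x. t \<le> w x} \<partial>lborel) = (\<integral>\<^sup>+x. ennreal (w x) \<partial>\<mu>2)"
    by (rule nn_integral_layer_cake[OF p2.finite_measure_axioms s2, symmetric]) (use w in auto)
  also have "(\<integral>\<^sup>+t\<in>{0..2 * c}. ennreal (tv_dist \<mu>1 \<mu>2) \<partial>lborel) = ennreal (2 * c * tv_dist \<mu>1 \<mu>2)"
    using c tv_dist_nonneg[OF p1 p2] by (simp add: nn_integral_cmult_indicator ennreal_mult' mult.commute)
  finally have "(\<integral>x. u x \<partial>\<mu>1) + c \<le> (\<integral>x. u x \<partial>\<mu>2) + c + 2 * c * tv_dist \<mu>1 \<mu>2"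
    using e nn c tv_dist_nonneg[OF p1 p2] by (simp flip: ennreal_plus)
  then show ?thesis by simp
qed

lemma abs_integral_diff_le_tv_dist:
  assumes "prob_space \<mu>1" "sets \<mu>1 = sets borel" "prob_space \<mu>2" "sets \<mu>2 = sets borel"
    and "bounded_borel c u"
  shows "\<bar>(\<integral>x. u x \<partial>\<mu>1) - (\<integral>x. u x \<partial>\<mu>2)\<bar> \<le> 2 * c * tv_dist \<mu>1 \<mu>2"
  using integral_le_tv_dist[OF assms] integral_le_tv_dist[OF assms(3,4,1,2,5)]
  by (simp add: tv_dist_commute[of \<mu>2] abs_le_iff)

text \<open>Successive ratios of a log-convex sequence do not decrease. A first ratio
  \<open>s > r\<close> would therefore force growth of order \<open>s ^ n\<close>, against the decay
  of order \<open>r ^ n\<close>. The constant \<open>C\<close> disappears: an asymptotic rate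
  becomes a bound for a single step.\<close>

lemma log_convex_ratio_le:
  fixes b :: "nat \<Rightarrow> real"
  assumes nn: "\<And>n. 0 \<le> b n"
    and convex: "\<And>n. (b (Suc n))\<^sup>2 \<le> b n * b (Suc (Suc n))"
    and decay: "\<And>n. 1 \<le> n \<Longrightarrow> b n \<le> C * r ^ n"
    and r: "0 \<le> r"
  shows "b 1 \<le> r * b 0"
proof (rule ccontr)
  assume "\<not> b 1 \<le> r * b 0"
  then have gt: "r * b 0 < b 1" by simp
  then have b1: "0 < b 1" using nn[of 0] r by (smt (verit) mult_nonneg_nonneg)
  have b0: "0 < b 0" using convex[of 0] b1 nn[of 0] by (cases "b 0 = 0") auto
  define s where "s = b 1 / b 0"
  have s: "r < s" "0 < s" using gt b0 b1 by (auto simp: s_def field_simps)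
  have step: "0 < b n \<and> s * b n \<le> b (Suc n)" for n
  proof (induction n)
    case 0
    then show ?case using b0 by (simp add: s_def)
  next
    case (Suc n)
    then have pos: "0 < b (Suc n)" using s by (smt (verit) mult_pos_pos)
    have "(s * b (Suc n)) * b n \<le> b (Suc n) * b (Suc n)"
      using Suc pos by (simp add: mult.commute mult.left_commute mult_left_mono)
    also have "\<dots> \<le> b (Suc (Suc n)) * b n"
      using convex[of n] by (simp add: power2_eq_square mult.commute)
    finally show ?case using Suc pos by simp
  qed
  have lower: "s ^ n * b 0 \<le> b n" for n
  proof (induction n)
    case (Suc n)
    then have "s * (s ^ n * b 0) \<le> s * b n" using s by simp
    also have "\<dots> \<le> b (Suc n)" using step by blast
    finally show ?case by (simp add: mult.assoc)
  qed simp
  have r0: "0 < r"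
  proof (rule ccontr)
    assume "\<not> 0 < r"
    then have "b 1 \<le> 0" using decay[of 1] r by simp
    then show False using b1 by simp
  qed
  obtain n where n: "C / b 0 < (s / r) ^ n"
    using real_arch_pow[of "s / r"] s r0 by auto
  \<comment> \<open>The decay is assumed only for exponents at least 1, and \<open>n\<close> may be
    0, so the comparison is moved to \<open>Suc n\<close>.\<close>
  have "(s / r) ^ n \<le> (s / r) ^ Suc n"
    using s r0 by (intro power_increasing) auto
  then have "C / b 0 < (s / r) ^ Suc n" using n by linarith
  then have "C * r ^ Suc n < s ^ Suc n * b 0"
    unfolding power_divide using b0 r0 by (simp add: field_simps del: power_Suc)
  then show False using lower[of "Suc n"] decay[of "Suc n"] by simp
qed

section \<open>Powers of the kernel and of the Markov operator\<close>

context kernel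
begin

lemma kernel_pow_prob: "prob_space (kernel_pow K n x) \<and> sets (kernel_pow K n x) = sets borel"
proof (induction n)
  case 0
  then show ?case by (simp add: prob_space_return)
next
  case (Suc n)
  have "prob_space (kernel_pow K n x \<bind> K)"
    using Suc kernel_subprob_algebra prob_space_kernel
    by (intro prob_space.prob_space_bind[where S = borel]) (auto cong: measurable_cong_sets)
  with Suc show ?case by (simp add: sets_bind_kernel)
qed

text \<open>\<open>kernel_pow\<close> appends each new step at the end, so the induction absorbs the
  last step into the integrand and needs \<open>u\<close> arbitrary.\<close>

lemma integral_kernel_pow:
  "bounded_borel c u \<Longrightarrow> (\<integral>y. u y \<partial>kernel_pow K n x) = (markov_op K ^^ n) u x"
proof (induction n arbitrary: u)
  case 0
  then show ?case by (simp add: integral_return bounded_borelD)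
next
  case (Suc n)
  have "(\<integral>y. u y \<partial>kernel_pow K (Suc n) x) = (\<integral>y. markov_op K u y \<partial>kernel_pow K n x)"
    using integral_bind_kernel[OF _ _ Suc.prems] kernel_pow_prob by (simp add: prob_space.finite_measure)
  also have "\<dots> = (markov_op K ^^ n) (markov_op K u) x"
    by (rule Suc.IH[OF bounded_borel_markov_op[OF Suc.prems]])
  finally show ?case by (simp add: funpow_swap1)
qed

end

context reversible_kernel
begin

lemma integrable_pi_power2: "bounded_borel c u \<Longrightarrow> integrable \<pi> (\<lambda>x. (u x)\<^sup>2)"
  using integrable_pi[OF bounded_borel_mult, of c u c u] by (simp add: power2_eq_square)

lemma Cauchy_Schwarz_pi:
  assumes "bounded_borel c u" "bounded_borel d v"
  shows "(\<integral>x. \<bar>u x * v x\<bar> \<partial>\<pi>)\<^sup>2 \<le> (\<integral>x. (u x)\<^sup>2 \<partial>\<pi>) * (\<integral>x. (v x)\<^sup>2 \<partial>\<pi>)"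
  by (rule Cauchy_Schwarz_integral[OF measurable_pi[OF bounded_borelD(1)[OF assms(1)]]
        measurable_pi[OF bounded_borelD(1)[OF assms(2)]] integrable_pi_power2[OF assms(1)]
        integrable_pi_power2[OF assms(2)] integrable_pi[OF bounded_borel_mult[OF assms]]])

lemma nn_integral_markov_pi:
  "u \<in> borel_measurable borel \<Longrightarrow> (\<integral>\<^sup>+x. \<integral>\<^sup>+y. u y \<partial>K x \<partial>\<pi>) = (\<integral>\<^sup>+x. u x \<partial>\<pi>)"
  using nn_integral_bind_kernel[OF sets_pi, of u] by (simp add: bind_kernel_pi)

text \<open>By invariance the iterated integral of \<open>\<bar>u\<bar>\<close> is its
  \<open>\<pi>\<close>-integral, so the inner integral is finite almost everywhere. This gives
  \<open>P f\<close> its proper meaning for unbounded \<open>f\<close>.\<close>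

lemma AE_integrable_kernel:
  fixes u :: "'a \<Rightarrow> real"
  assumes [measurable]: "u \<in> borel_measurable borel" and "integrable \<pi> u"
  shows "AE x in \<pi>. integrable (K x) u"
proof -
  have "(\<integral>\<^sup>+x. \<integral>\<^sup>+y. ennreal \<bar>u y\<bar> \<partial>K x \<partial>\<pi>) \<noteq> \<infinity>"
    using assms(2) by (simp add: nn_integral_markov_pi integrable_iff_bounded)
  then have "AE x in \<pi>. (\<integral>\<^sup>+y. ennreal \<bar>u y\<bar> \<partial>K x) \<noteq> \<infinity>"
    by (intro nn_integral_PInf_AE measurable_pi
        measurable_compose[OF kernel_subprob_algebra nn_integral_measurable_subprob_algebra]) auto
  then show ?thesis
    by eventually_elim (auto simp: integrable_iff_bounded less_top)
qed

end

section \<open>Contraction of bounded mean-zero functions\<close>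

locale uniformly_ergodic_kernel = reversible_kernel +
  fixes \<alpha> M :: real
  assumes ergodic: "uniformly_ergodic K \<pi> \<alpha> M"
begin

lemma alpha: "0 \<le> \<alpha>" "\<alpha> < 1" and M: "0 < M"
  using ergodic by (auto simp: uniformly_ergodic_def)

text \<open>Integrating \<open>u\<close> against the \<open>n\<close>-step kernel turns the total
  variation bound into one for \<open>P ^^ n\<close>, at the cost of \<open>2 * c\<close>. The null
  set is the one in the ergodicity assumption, common to all \<open>n\<close>.\<close>

lemma markov_op_pow_converges:
  assumes u: "bounded_borel c u"
  shows "AE x in \<pi>. \<forall>n\<ge>1. \<bar>(P ^^ n) u x - (\<integral>y. u y \<partial>\<pi>)\<bar> \<le> 2 * c * M * \<alpha> ^ n"
proof -
  have "AE x in \<pi>. \<forall>n\<ge>1. tv_dist (kernel_pow K n x) \<pi> \<le> \<alpha> ^ n * M"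
    using ergodic by (simp add: uniformly_ergodic_def)
  then show ?thesis
  proof eventually_elim
    case (elim x)
    have c: "0 \<le> c" using bounded_borelD(2)[OF u, of x] by linarith
    show ?case
    proof (intro allI impI)
      fix n :: nat assume "1 \<le> n"
      have "\<bar>(P ^^ n) u x - (\<integral>y. u y \<partial>\<pi>)\<bar> \<le> 2 * c * tv_dist (kernel_pow K n x) \<pi>"
        using abs_integral_diff_le_tv_dist[OF _ _ prob_space_axioms sets_pi u, of "kernel_pow K n x"]
          kernel_pow_prob[of n x] by (simp add: integral_kernel_pow[OF u])
      also have "\<dots> \<le> 2 * c * (\<alpha> ^ n * M)"
        using elim \<open>1 \<le> n\<close> c by (intro mult_left_mono) auto
      finally show "\<bar>(P ^^ n) u x - (\<integral>y. u y \<partial>\<pi>)\<bar> \<le> 2 * c * M * \<alpha> ^ n"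
        by (simp add: mult_ac)
    qed
  qed
qed

text \<open>The squared norms of \<open>(P ^^ n) u\<close> are log-convex by self-adjointness and
  Cauchy-Schwarz, and of order \<open>(\<alpha>\<^sup>2) ^ n\<close> by ergodicity. The ratio lemma
  then gives one-step contraction without the constant \<open>M\<close>.\<close>

lemma contraction_mean_zero:
  assumes u: "bounded_borel c u" and mean: "(\<integral>x. u x \<partial>\<pi>) = 0"
  shows "(\<integral>x. (P u x)\<^sup>2 \<partial>\<pi>) \<le> \<alpha>\<^sup>2 * (\<integral>x. (u x)\<^sup>2 \<partial>\<pi>)"
proof -
  define b where "b n = (\<integral>x. ((P ^^ n) u x)\<^sup>2 \<partial>\<pi>)" for n
  note pow = bounded_borel_markov_op_pow[OF u]
  have "b 1 \<le> \<alpha>\<^sup>2 * b 0"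
  proof (rule log_convex_ratio_le)
    show "0 \<le> b n" for n by (simp add: b_def)
    show "(b (Suc n))\<^sup>2 \<le> b n * b (Suc (Suc n))" for n
    proof -
      \<comment> \<open>One application of \<open>P\<close> is moved from one factor to the
        other.\<close>
      have "b (Suc n) = (\<integral>x. (P ^^ n) u x * (P ^^ Suc (Suc n)) u x \<partial>\<pi>)"
        using self_adjoint[OF pow[of n] pow[of "Suc n"]]
        by (simp add: b_def power2_eq_square)
      also have "\<bar>\<dots>\<bar> \<le> (\<integral>x. \<bar>(P ^^ n) u x * (P ^^ Suc (Suc n)) u x\<bar> \<partial>\<pi>)"
        by (rule integral_abs_bound)
      finally have "(b (Suc n))\<^sup>2 \<le> (\<integral>x. \<bar>(P ^^ n) u x * (P ^^ Suc (Suc n)) u x\<bar> \<partial>\<pi>)\<^sup>2"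
        by (simp add: abs_le_square_iff[symmetric])
      also have "\<dots> \<le> b n * b (Suc (Suc n))"
        unfolding b_def by (rule Cauchy_Schwarz_pi[OF pow pow])
      finally show ?thesis .
    qed
    show "b n \<le> (2 * c * M)\<^sup>2 * (\<alpha>\<^sup>2) ^ n" if "1 \<le> n" for n
    proof -
      have "b n \<le> (\<integral>x. (2 * c * M * \<alpha> ^ n)\<^sup>2 \<partial>\<pi>)"
        unfolding b_def
      proof (rule integral_mono_AE)
        show "AE x in \<pi>. ((P ^^ n) u x)\<^sup>2 \<le> (2 * c * M * \<alpha> ^ n)\<^sup>2"
          using markov_op_pow_converges[OF u]
        proof eventually_elim
          case (elim x)
          then have "\<bar>(P ^^ n) u x\<bar> \<le> 2 * c * M * \<alpha> ^ n"
            using that mean by simp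
          then show ?case
            using power_mono[of "\<bar>(P ^^ n) u x\<bar>" _ 2] by simp
        qed
      qed (use integrable_pi_power2[OF pow] in auto)
      then show ?thesis
        by (simp add: prob_space power_mult_distrib power_even_eq flip: power_mult)
    qed
  qed simp
  then show ?thesis by (simp add: b_def)
qed

end

section \<open>Extension to L2 and the operator norm\<close>

context prob_space
begin

lemma Lp_norm_2: "Lp_norm M 2 f = sqrt (\<integral>x. (f x)\<^sup>2 \<partial>M)"
  by (simp add: Lp_norm_def powr_half_sqrt)

lemma Lp_space_2: "f \<in> Lp_space M 2 \<longleftrightarrow> f \<in> borel_measurable M \<and> integrable M (\<lambda>x. (f x)\<^sup>2)"
  by (simp add: Lp_space_def)

lemma integrable_of_power2:
  assumes "f \<in> borel_measurable M" "integrable M (\<lambda>x. (f x)\<^sup>2 :: real)"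
  shows "integrable M f"
  using square_integrable_imp_integrable[OF assms] .

end

context reversible_kernel
begin

definition centred_op :: "('a \<Rightarrow> real) \<Rightarrow> 'a \<Rightarrow> real" where
  "centred_op f x = P f x - (\<integral>y. f y \<partial>\<pi>)"

lemma gap_eq: "gap K \<pi> = 1 - L2_opnorm \<pi> centred_op"
  by (simp add: gap_def centred_op_def[abs_def])

lemma integral_centred_power2_le:
  assumes "bounded_borel c f"
  shows "(\<integral>x. (f x - (\<integral>y. f y \<partial>\<pi>))\<^sup>2 \<partial>\<pi>) \<le> (\<integral>x. (f x)\<^sup>2 \<partial>\<pi>)"
  using variance_eq[OF integrable_pi[OF assms] integrable_pi_power2[OF assms]] by simp

lemma bounded_borel_centred:
  "bounded_borel c f \<Longrightarrow> bounded_borel (c + \<bar>\<integral>y. f y \<partial>\<pi>\<bar>) (\<lambda>x. f x - (\<integral>y. f y \<partial>\<pi>))"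
  using bounded_borel_add_const[of c f "- (\<integral>y. f y \<partial>\<pi>)"] by simp

end

context uniformly_ergodic_kernel
begin

text \<open>\<open>P\<close> fixes constants, so \<open>centred_op f\<close> is \<open>P\<close>
  applied to the centred function; the variance of \<open>f\<close> is at most its second
  moment.\<close>

lemma centred_op_contraction_bounded:
  assumes f: "bounded_borel c f"
  shows "(\<integral>x. (centred_op f x)\<^sup>2 \<partial>\<pi>) \<le> \<alpha>\<^sup>2 * (\<integral>x. (f x)\<^sup>2 \<partial>\<pi>)"
proof -
  let ?u = "\<lambda>x. f x - (\<integral>y. f y \<partial>\<pi>)"
  have "centred_op f = P ?u"
    using markov_op_add_const[OF f, of "- (\<integral>y. f y \<partial>\<pi>)"] by (auto simp: centred_op_def)
  moreover have "(\<integral>x. ?u x \<partial>\<pi>) = 0"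
    using integrable_pi[OF f] by (simp add: prob_space)
  ultimately have "(\<integral>x. (centred_op f x)\<^sup>2 \<partial>\<pi>) \<le> \<alpha>\<^sup>2 * (\<integral>x. (?u x)\<^sup>2 \<partial>\<pi>)"
    using contraction_mean_zero[OF bounded_borel_centred[OF f]] by simp
  also have "\<dots> \<le> \<alpha>\<^sup>2 * (\<integral>x. (f x)\<^sup>2 \<partial>\<pi>)"
    by (intro mult_left_mono integral_centred_power2_le[OF f]) simp
  finally show ?thesis .
qed

text \<open>The bounded case extends to \<open>L\<^sub>2\<close> by truncation and Fatou's lemma.\<close>
lemma centred_op_contraction:
  assumes [measurable]: "f \<in> borel_measurable borel" and f2: "integrable \<pi> (\<lambda>x. (f x)\<^sup>2)"
  shows "(\<integral>x. (centred_op f x)\<^sup>2 \<partial>\<pi>) \<le> \<alpha>\<^sup>2 * (\<integral>x. (f x)\<^sup>2 \<partial>\<pi>)"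
proof -
  \<comment> \<open>Each \<open>F k\<close> is bounded, dominated by \<open>f\<close>, and at every
    point equal to \<open>f\<close> from some \<open>k\<close> on.\<close>
  define F where "F k x = f x * indicator {x. \<bar>f x\<bar> \<le> real k} x" for k :: nat and x
  have F: "bounded_borel (real k) (F k)" for k
    by (auto simp: bounded_borel_def F_def[abs_def] indicator_def)
  have F_le: "\<bar>F k x\<bar> \<le> \<bar>f x\<bar>" for k x
    by (simp add: F_def indicator_def)
  have F_lim: "(\<lambda>k. F k x) \<longlonglongrightarrow> f x" for x
  proof (rule tendsto_eventually)
    have "F k x = f x" if "nat \<lceil>\<bar>f x\<bar>\<rceil> \<le> k" for k
    proof -
      have "\<bar>f x\<bar> \<le> real (nat \<lceil>\<bar>f x\<bar>\<rceil>)" by (rule real_nat_ceiling_ge)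
      also have "\<dots> \<le> real k" using that by (simp only: of_nat_le_iff)
      finally have "\<bar>f x\<bar> \<le> real k" .
      then show ?thesis by (simp add: F_def)
    qed
    then show "eventually (\<lambda>k. F k x = f x) sequentially"
      unfolding eventually_sequentially by blast
  qed
  have [measurable]: "F k \<in> borel_measurable borel" for k
    by (rule bounded_borelD[OF F])
  have int: "integrable \<pi> f"
    by (rule integrable_of_power2[OF measurable_pi f2]) simp
  have T_meas: "centred_op g \<in> borel_measurable \<pi>" if "g \<in> borel_measurable borel" for g
    unfolding centred_op_def[abs_def] using that by (intro measurable_pi borel_measurable_diff markov_op_measurable borel_measurable_const)
  \<comment> \<open>Dominated convergence is used twice, under \<open>K x\<close> and under
    \<open>\<pi>\<close>; the first needs \<open>f\<close> integrable for \<open>K x\<close>, which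
    holds only for almost every \<open>x\<close>.\<close>
  have lim: "AE x in \<pi>. (\<lambda>k. centred_op (F k) x) \<longlonglongrightarrow> centred_op f x"
    using AE_integrable_kernel[OF assms(1) int]
  proof eventually_elim
    case (elim x)
    have "(\<lambda>k. \<integral>y. F k y \<partial>K x) \<longlonglongrightarrow> (\<integral>y. f y \<partial>K x)"
      by (rule integral_dominated_convergence[where w = "\<lambda>y. \<bar>f y\<bar>"])
         (use elim F_lim F_le in \<open>auto cong: measurable_cong_sets[OF sets_kernel]\<close>)
    moreover have "(\<lambda>k. \<integral>y. F k y \<partial>\<pi>) \<longlonglongrightarrow> (\<integral>y. f y \<partial>\<pi>)"
      by (rule integral_dominated_convergence[where w = "\<lambda>y. \<bar>f y\<bar>"])
         (use int F_lim F_le measurable_pi in auto)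
    ultimately show ?case
      unfolding centred_op_def markov_op_def by (rule tendsto_diff)
  qed
  have bound: "(\<integral>\<^sup>+x. ennreal ((centred_op (F k) x)\<^sup>2) \<partial>\<pi>) \<le> ennreal (\<alpha>\<^sup>2 * (\<integral>x. (f x)\<^sup>2 \<partial>\<pi>))" for k
  proof -
    have "bounded_borel (real k + \<bar>\<integral>y. F k y \<partial>\<pi>\<bar>) (centred_op (F k))"
      using bounded_borel_add_const[OF bounded_borel_markov_op[OF F], of k "- (\<integral>y. F k y \<partial>\<pi>)"]
      by (simp add: centred_op_def[abs_def])
    then have "(\<integral>\<^sup>+x. ennreal ((centred_op (F k) x)\<^sup>2) \<partial>\<pi>) = ennreal (\<integral>x. (centred_op (F k) x)\<^sup>2 \<partial>\<pi>)"
      by (intro nn_integral_eq_integral integrable_pi_power2) auto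
    also have "(\<integral>x. (centred_op (F k) x)\<^sup>2 \<partial>\<pi>) \<le> \<alpha>\<^sup>2 * (\<integral>x. (F k x)\<^sup>2 \<partial>\<pi>)"
      by (rule centred_op_contraction_bounded[OF F])
    also have "\<dots> \<le> \<alpha>\<^sup>2 * (\<integral>x. (f x)\<^sup>2 \<partial>\<pi>)"
      using F_le integrable_pi_power2[OF F] f2
      by (intro mult_left_mono integral_mono) (auto simp: abs_le_square_iff)
    finally show ?thesis by (simp add: ennreal_leI)
  qed
  have "(\<integral>\<^sup>+x. ennreal ((centred_op f x)\<^sup>2) \<partial>\<pi>)
      = (\<integral>\<^sup>+x. liminf (\<lambda>k. ennreal ((centred_op (F k) x)\<^sup>2)) \<partial>\<pi>)"
  proof (rule nn_integral_cong_AE)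
    show "AE x in \<pi>. ennreal ((centred_op f x)\<^sup>2) = liminf (\<lambda>k. ennreal ((centred_op (F k) x)\<^sup>2))"
      using lim
    proof eventually_elim
      case (elim x)
      have "(\<lambda>k. ennreal ((centred_op (F k) x)\<^sup>2)) \<longlonglongrightarrow> ennreal ((centred_op f x)\<^sup>2)"
        by (intro tendsto_intros elim)
      then show ?case
        by (rule lim_imp_Liminf[OF trivial_limit_sequentially, symmetric])
    qed
  qed
  also have "\<dots> \<le> liminf (\<lambda>k. \<integral>\<^sup>+x. ennreal ((centred_op (F k) x)\<^sup>2) \<partial>\<pi>)"
    using T_meas by (intro nn_integral_liminf) auto
  also have "\<dots> \<le> ennreal (\<alpha>\<^sup>2 * (\<integral>x. (f x)\<^sup>2 \<partial>\<pi>))"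
    by (rule Liminf_le) (use bound in auto)
  finally have le: "(\<integral>\<^sup>+x. ennreal ((centred_op f x)\<^sup>2) \<partial>\<pi>) \<le> ennreal (\<alpha>\<^sup>2 * (\<integral>x. (f x)\<^sup>2 \<partial>\<pi>))" .
  have "(\<integral>x. (centred_op f x)\<^sup>2 \<partial>\<pi>) = enn2real (\<integral>\<^sup>+x. ennreal ((centred_op f x)\<^sup>2) \<partial>\<pi>)"
    using T_meas[OF assms(1)] by (intro integral_eq_nn_integral) auto
  also have "\<dots> \<le> enn2real (ennreal (\<alpha>\<^sup>2 * (\<integral>x. (f x)\<^sup>2 \<partial>\<pi>)))"
    using le by (intro enn2real_mono) auto
  finally show ?thesis by simp
qed

lemma Lp_norm_centred_op_le:
  assumes f: "f \<in> Lp_space \<pi> 2"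
  shows "Lp_norm \<pi> 2 (centred_op f) \<le> \<alpha> * Lp_norm \<pi> 2 f"
proof -
  have "f \<in> borel_measurable borel"
    using f sets_pi by (simp add: Lp_space_2 cong: measurable_cong_sets)
  then have "sqrt (\<integral>x. (centred_op f x)\<^sup>2 \<partial>\<pi>) \<le> sqrt (\<alpha>\<^sup>2 * (\<integral>x. (f x)\<^sup>2 \<partial>\<pi>))"
    using f by (intro real_sqrt_le_mono centred_op_contraction) (auto simp: Lp_space_2)
  then show ?thesis
    using alpha by (simp add: Lp_norm_2 real_sqrt_mult)
qed

text \<open>Contraction by \<open>\<alpha>\<close> bounds the set under the supremum, so the
  real-valued supremum is the true operator norm. The zero function shows that the set is nonempty
  and the norm nonnegative.\<close>

lemma L2_opnorm_bounds:
  shows L2_opnorm_nonneg: "0 \<le> L2_opnorm \<pi> centred_op"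
    and L2_opnorm_le: "L2_opnorm \<pi> centred_op \<le> \<alpha>"
    and Lp_norm_centred_op_le_opnorm:
      "\<lbrakk>f \<in> Lp_space \<pi> 2; Lp_norm \<pi> 2 f \<le> 1\<rbrakk> \<Longrightarrow> Lp_norm \<pi> 2 (centred_op f) \<le> L2_opnorm \<pi> centred_op"
proof -
  let ?B = "{f \<in> Lp_space \<pi> 2. Lp_norm \<pi> 2 f \<le> 1}"
  have le: "Lp_norm \<pi> 2 (centred_op f) \<le> \<alpha>" if "f \<in> ?B" for f
    using Lp_norm_centred_op_le[of f] that alpha mult_left_le[of "Lp_norm \<pi> 2 f" \<alpha>] by auto
  have zero: "(\<lambda>x. 0) \<in> ?B"
    by (simp add: Lp_space_2 Lp_norm_2)
  have bdd: "bdd_above ((\<lambda>f. Lp_norm \<pi> 2 (centred_op f)) ` ?B)"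
    using le by (auto intro!: bdd_aboveI[of _ \<alpha>])
  show upper: "Lp_norm \<pi> 2 (centred_op f) \<le> L2_opnorm \<pi> centred_op"
    if "f \<in> Lp_space \<pi> 2" "Lp_norm \<pi> 2 f \<le> 1" for f
    unfolding L2_opnorm_def using that by (intro cSUP_upper bdd) auto
  show "0 \<le> L2_opnorm \<pi> centred_op"
    using upper[of "\<lambda>x. 0"] zero by (simp add: Lp_norm_2 centred_op_def markov_op_def)
  show "L2_opnorm \<pi> centred_op \<le> \<alpha>"
    unfolding L2_opnorm_def using zero le by (intro cSUP_least) auto
qed

section \<open>Decay of correlations at the rate of the gap\<close>

text \<open>By \<open>gap_eq\<close> this is the L2 norm of \<open>centred_op\<close>; it replaces
  \<open>\<alpha>\<close> as the geometric rate from here on.\<close>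

definition \<beta> :: real where "\<beta> = 1 - gap K \<pi>"

lemma beta: "0 \<le> \<beta>" "\<beta> < 1"
  using L2_opnorm_nonneg L2_opnorm_le alpha by (auto simp: \<beta>_def gap_eq)

text \<open>On mean-zero functions \<open>P\<close> and \<open>centred_op\<close> agree, so the
  operator norm applies after scaling \<open>u\<close> to norm 1. If the norm of \<open>u\<close> is
  0, contraction by \<open>\<alpha>\<close> makes the left side vanish.\<close>

lemma gap_contraction:
  assumes u: "bounded_borel c u" and mean: "(\<integral>x. u x \<partial>\<pi>) = 0"
  shows "(\<integral>x. (P u x)\<^sup>2 \<partial>\<pi>) \<le> \<beta>\<^sup>2 * (\<integral>x. (u x)\<^sup>2 \<partial>\<pi>)"
proof (cases "(\<integral>x. (u x)\<^sup>2 \<partial>\<pi>) = 0")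
  case True
  then show ?thesis using contraction_mean_zero[OF assms] by simp
next
  case False
  define s where "s = sqrt (\<integral>x. (u x)\<^sup>2 \<partial>\<pi>)"
  have s: "0 < s" "s\<^sup>2 = (\<integral>x. (u x)\<^sup>2 \<partial>\<pi>)"
    using False by (auto simp: s_def order_less_le)
  let ?v = "\<lambda>x. u x / s"
  have v2: "(\<integral>x. (?v x)\<^sup>2 \<partial>\<pi>) = 1"
    using False by (simp only: power_divide integral_divide_zero s(2)) simp
  have op: "centred_op ?v = (\<lambda>x. P u x / s)"
    using mean by (simp add: centred_op_def[abs_def] markov_op_def[abs_def])
  have "integrable \<pi> (\<lambda>x. (?v x)\<^sup>2)"
    unfolding power_divide by (intro integrable_divide integrable_pi_power2[OF u])
  moreover have "?v \<in> borel_measurable \<pi>"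
    by (intro measurable_pi borel_measurable_divide borel_measurable_const bounded_borelD(1)[OF u])
  ultimately have "?v \<in> Lp_space \<pi> 2"
    unfolding Lp_space_2 by blast
  moreover have "Lp_norm \<pi> 2 ?v \<le> 1"
    unfolding Lp_norm_2 v2 by simp
  ultimately have "Lp_norm \<pi> 2 (centred_op ?v) \<le> \<beta>"
    unfolding \<beta>_def gap_eq using Lp_norm_centred_op_le_opnorm[of ?v] by linarith
  then have "sqrt ((\<integral>x. (P u x)\<^sup>2 \<partial>\<pi>) / s\<^sup>2) \<le> \<beta>"
    by (simp add: op Lp_norm_2 power_divide)
  then have "(\<integral>x. (P u x)\<^sup>2 \<partial>\<pi>) / s\<^sup>2 \<le> \<beta>\<^sup>2"
    by (rule sqrt_le_D)
  moreover have "0 < s\<^sup>2" using s(1) by simp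
  ultimately show ?thesis
    unfolding s(2) by (simp only: pos_divide_le_eq)
qed

lemma gap_contraction_pow:
  assumes u: "bounded_borel c u" and mean: "(\<integral>x. u x \<partial>\<pi>) = 0"
  shows "(\<integral>x. ((P ^^ k) u x)\<^sup>2 \<partial>\<pi>) \<le> (\<beta> ^ k)\<^sup>2 * (\<integral>x. (u x)\<^sup>2 \<partial>\<pi>)"
proof (induction k)
  case (Suc k)
  have "(\<integral>x. ((P ^^ Suc k) u x)\<^sup>2 \<partial>\<pi>) \<le> \<beta>\<^sup>2 * (\<integral>x. ((P ^^ k) u x)\<^sup>2 \<partial>\<pi>)"
    using gap_contraction[OF bounded_borel_markov_op_pow[OF u]] mean integral_markov_op_pow[OF u]
    by simp
  also have "\<dots> \<le> \<beta>\<^sup>2 * ((\<beta> ^ k)\<^sup>2 * (\<integral>x. (u x)\<^sup>2 \<partial>\<pi>))"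
    using Suc by (intro mult_left_mono) auto
  finally show ?case by (simp add: power_mult_distrib mult_ac)
qed simp

text \<open>By Cauchy-Schwarz the left side is at most the product of the L2 norms of
  \<open>u\<close> and \<open>(P ^^ k) u\<close>, and the second carries the factor
  \<open>\<beta> ^ k\<close>.\<close>

lemma correlation_le:
  assumes u: "bounded_borel c u" and mean: "(\<integral>x. u x \<partial>\<pi>) = 0"
  shows "(\<integral>x. \<bar>u x * (P ^^ k) u x\<bar> \<partial>\<pi>) \<le> \<beta> ^ k * (\<integral>x. (u x)\<^sup>2 \<partial>\<pi>)"
proof (rule power2_le_imp_le)
  have "(\<integral>x. \<bar>u x * (P ^^ k) u x\<bar> \<partial>\<pi>)\<^sup>2 \<le> (\<integral>x. (u x)\<^sup>2 \<partial>\<pi>) * (\<integral>x. ((P ^^ k) u x)\<^sup>2 \<partial>\<pi>)"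
    by (rule Cauchy_Schwarz_pi[OF u bounded_borel_markov_op_pow[OF u]])
  also have "\<dots> \<le> (\<integral>x. (u x)\<^sup>2 \<partial>\<pi>) * ((\<beta> ^ k)\<^sup>2 * (\<integral>x. (u x)\<^sup>2 \<partial>\<pi>))"
    by (intro mult_left_mono gap_contraction_pow[OF assms]) simp
  finally show "(\<integral>x. \<bar>u x * (P ^^ k) u x\<bar> \<partial>\<pi>)\<^sup>2 \<le> (\<beta> ^ k * (\<integral>x. (u x)\<^sup>2 \<partial>\<pi>))\<^sup>2"
    by (simp add: power2_eq_square mult_ac)
  show "0 \<le> \<beta> ^ k * (\<integral>x. (u x)\<^sup>2 \<partial>\<pi>)"
    using beta by simp
qed

end

section \<open>Moments along the chain\<close>

locale markov_process = kernel K + O: prob_space \<Omega>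
  for K :: "'a::metric_space \<Rightarrow> 'a measure" and \<Omega> :: "'w measure" +
  fixes X :: "nat \<Rightarrow> 'w \<Rightarrow> 'a"
  assumes X_measurable [measurable]: "X n \<in> \<Omega> \<rightarrow>\<^sub>M borel"
    and markov_property: "A \<in> sets borel \<Longrightarrow> AE \<omega> in \<Omega>.
      real_cond_exp \<Omega> (past_algebra \<Omega> X n) (\<lambda>\<omega>'. indicator A (X (Suc n) \<omega>')) \<omega> = measure (K (X n \<omega>)) A"
begin

lemma past_space:
  "(\<lambda>\<omega>. \<lambda>i\<in>{..n}. X i \<omega>) \<in> space \<Omega> \<rightarrow> space (PiM {..n} (\<lambda>_. borel))"
  by (auto simp: space_PiM)

lemma subalgebra_past: "subalgebra \<Omega> (past_algebra \<Omega> X n)"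
proof -
  have [measurable]: "(\<lambda>\<omega>. \<lambda>i\<in>{..n}. X i \<omega>) \<in> \<Omega> \<rightarrow>\<^sub>M PiM {..n} (\<lambda>_. borel)"
    by (rule measurable_restrict) simp
  show ?thesis
    unfolding subalgebra_def past_algebra_def
    by (auto simp: sets_vimage_algebra2[OF past_space])
qed

lemma X_measurable_past:
  assumes "i \<le> n"
  shows "X i \<in> past_algebra \<Omega> X n \<rightarrow>\<^sub>M borel"
proof -
  have "(\<lambda>\<omega>. (\<lambda>i\<in>{..n}. X i \<omega>) i) \<in> past_algebra \<Omega> X n \<rightarrow>\<^sub>M borel"
    unfolding past_algebra_def using assms
    by (intro measurable_compose[OF measurable_vimage_algebra1[OF past_space]
          measurable_component_singleton]) auto
  then show ?thesis using assms by simp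
qed

lemma integrable_product:
  assumes "bounded_borel c \<phi>" "bounded_borel d \<psi>"
  shows "integrable \<Omega> (\<lambda>\<omega>. \<phi> (X i \<omega>) * \<psi> (X j \<omega>))"
proof (rule O.integrable_const_bound[of _ "c * d"])
  have [measurable]: "\<phi> \<in> borel_measurable borel" "\<psi> \<in> borel_measurable borel"
    using assms by (auto simp: bounded_borel_def)
  show "(\<lambda>\<omega>. \<phi> (X i \<omega>) * \<psi> (X j \<omega>)) \<in> borel_measurable \<Omega>" by measurable
  have "\<bar>\<phi> x * \<psi> y\<bar> \<le> c * d" for x y
    unfolding abs_mult
    by (intro mult_mono bounded_borelD(2)[OF assms(1)] bounded_borelD(2)[OF assms(2)])
       (use order_trans[OF abs_ge_zero bounded_borelD(2)[OF assms(1)]] in auto)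
  then show "AE \<omega> in \<Omega>. norm (\<phi> (X i \<omega>) * \<psi> (X j \<omega>)) \<le> c * d" by simp
qed

text \<open>The weight \<open>\<phi> (X i)\<close> is known at time \<open>n\<close>, so it passes
  through the conditional expectation. Stating the Markov property for weighted laws makes the facts
  about \<open>\<bind> K\<close> available for joint moments.\<close>

lemma distr_Suc_weighted:
  assumes phi: "bounded_borel c \<phi>" "\<And>x. 0 \<le> \<phi> x" and "i \<le> n"
  shows "distr (density \<Omega> (\<lambda>\<omega>. ennreal (\<phi> (X i \<omega>)))) borel (X (Suc n))
    = distr (density \<Omega> (\<lambda>\<omega>. ennreal (\<phi> (X i \<omega>)))) borel (X n) \<bind> K" (is "?L = ?R")
proof (rule measure_eqI)
  show "sets ?L = sets ?R"
    by (simp add: sets_bind_kernel)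
next
  fix A assume "A \<in> sets ?L"
  then have A [measurable]: "A \<in> sets borel" by simp
  have [measurable]: "\<phi> \<in> borel_measurable borel" by (rule bounded_borelD[OF phi(1)])
  interpret finite_measure_subalgebra \<Omega> "past_algebra \<Omega> X n"
    by unfold_locales (rule subalgebra_past)
  let ?g = "\<lambda>\<omega>. indicator A (X (Suc n) \<omega>) :: real"
  have int: "integrable \<Omega> (\<lambda>\<omega>. \<phi> (X i \<omega>) * ?g \<omega>)"
    by (rule integrable_product[OF phi(1), of 1]) (auto simp: bounded_borel_def)
  have meas: "(\<lambda>\<omega>. \<phi> (X i \<omega>)) \<in> borel_measurable (past_algebra \<Omega> X n)"
    by (rule measurable_compose[OF X_measurable_past[OF \<open>i \<le> n\<close>]]) simp
  note cond = real_cond_exp_intg[OF int meas]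
  have ae: "AE \<omega> in \<Omega>. \<phi> (X i \<omega>) * real_cond_exp \<Omega> (past_algebra \<Omega> X n) ?g \<omega>
      = \<phi> (X i \<omega>) * measure (K (X n \<omega>)) A"
    using markov_property[OF A, of n] by eventually_elim simp
  have [measurable]: "(\<lambda>\<omega>. measure (K (X n \<omega>)) A) \<in> borel_measurable \<Omega>"
    by (rule measurable_compose[OF X_measurable
          measurable_compose[OF kernel_subprob_algebra measurable_measure_subprob_algebra[OF A]]])
  have [measurable]: "(\<lambda>x. emeasure (K x) A) \<in> borel_measurable borel"
    by (rule measurable_compose[OF kernel_subprob_algebra measurable_emeasure_subprob_algebra[OF A]])
  have int': "integrable \<Omega> (\<lambda>\<omega>. \<phi> (X i \<omega>) * measure (K (X n \<omega>)) A)"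
    using cond(1) by (subst integrable_cong_AE[symmetric, OF _ _ ae]) auto
  have eq: "(\<integral>\<omega>. \<phi> (X i \<omega>) * ?g \<omega> \<partial>\<Omega>) = (\<integral>\<omega>. \<phi> (X i \<omega>) * measure (K (X n \<omega>)) A \<partial>\<Omega>)"
    using cond(2) integral_cong_AE[OF _ _ ae] by simp
  have "emeasure ?L A = (\<integral>\<^sup>+\<omega>. ennreal (\<phi> (X i \<omega>)) * indicator (X (Suc n) -` A \<inter> space \<Omega>) \<omega> \<partial>\<Omega>)"
    by (simp add: emeasure_distr emeasure_density)
  also have "\<dots> = (\<integral>\<^sup>+\<omega>. ennreal (\<phi> (X i \<omega>) * ?g \<omega>) \<partial>\<Omega>)"
    by (intro nn_integral_cong) (auto simp: indicator_def)
  also have "\<dots> = (\<integral>\<^sup>+\<omega>. ennreal (\<phi> (X i \<omega>) * measure (K (X n \<omega>)) A) \<partial>\<Omega>)"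
    using int int' eq phi(2) by (simp add: nn_integral_eq_integral)
  also have "\<dots> = (\<integral>\<^sup>+\<omega>. ennreal (\<phi> (X i \<omega>)) * emeasure (K (X n \<omega>)) A \<partial>\<Omega>)"
    using phi(2) finite_measure.emeasure_eq_measure[OF prob_space.finite_measure[OF prob_space_kernel]]
    by (simp add: ennreal_mult)
  also have "\<dots> = emeasure ?R A"
    by (simp add: emeasure_bind_kernel nn_integral_distr nn_integral_density)
  finally show "emeasure ?L A = emeasure ?R A" .
qed

lemma distr_Suc: "distr \<Omega> borel (X (Suc n)) = distr \<Omega> borel (X n) \<bind> K"
  using distr_Suc_weighted[of 1 "\<lambda>_. 1" n n] by (simp add: bounded_borel_def density_1)

lemma expectation_Suc_nonneg:
  assumes phi: "bounded_borel c \<phi>" "\<And>x. 0 \<le> \<phi> x" and psi: "bounded_borel d \<psi>" and "i \<le> n"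
  shows "(\<integral>\<omega>. \<phi> (X i \<omega>) * \<psi> (X (Suc n) \<omega>) \<partial>\<Omega>) = (\<integral>\<omega>. \<phi> (X i \<omega>) * markov_op K \<psi> (X n \<omega>) \<partial>\<Omega>)"
proof -
  have [measurable]: "\<phi> \<in> borel_measurable borel" "\<psi> \<in> borel_measurable borel"
    using bounded_borelD(1)[OF phi(1)] bounded_borelD(1)[OF psi] by auto
  let ?D = "density \<Omega> (\<lambda>\<omega>. ennreal (\<phi> (X i \<omega>)))"
  have fin: "finite_measure ?D"
    using O.integrable_bounded_borel_comp[OF X_measurable phi(1)] phi(2)
    by (intro finite_measureI) (simp add: emeasure_density nn_integral_eq_integral cong: nn_integral_cong)
  have "(\<integral>\<omega>. \<phi> (X i \<omega>) * \<psi> (X (Suc n) \<omega>) \<partial>\<Omega>) = (\<integral>x. \<psi> x \<partial>distr ?D borel (X (Suc n)))"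
    using phi(2) by (simp add: integral_distr integral_density)
  also have "\<dots> = (\<integral>x. markov_op K \<psi> x \<partial>distr ?D borel (X n))"
    unfolding distr_Suc_weighted[OF phi \<open>i \<le> n\<close>]
    by (rule integral_bind_kernel[OF finite_measure.finite_measure_distr[OF fin] _ psi]) auto
  also have "\<dots> = (\<integral>\<omega>. \<phi> (X i \<omega>) * markov_op K \<psi> (X n \<omega>) \<partial>\<Omega>)"
    using phi(2) by (simp add: integral_distr integral_density)
  finally show ?thesis .
qed

text \<open>Adding \<open>c\<close> makes \<open>\<phi>\<close> nonnegative; the added term is
  \<open>c\<close> times the identity for the weight 1 and is subtracted again.\<close>

lemma expectation_Suc:
  assumes phi: "bounded_borel c \<phi>" and psi: "bounded_borel d \<psi>" and "i \<le> n"
  shows "(\<integral>\<omega>. \<phi> (X i \<omega>) * \<psi> (X (Suc n) \<omega>) \<partial>\<Omega>) = (\<integral>\<omega>. \<phi> (X i \<omega>) * markov_op K \<psi> (X n \<omega>) \<partial>\<Omega>)"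
proof -
  have one: "bounded_borel 1 (\<lambda>_::'a. 1)" by (simp add: bounded_borel_def)
  have "0 \<le> \<phi> x + c" for x
    using bounded_borelD(2)[OF phi, of x] by auto
  from expectation_Suc_nonneg[OF bounded_borel_add_const[OF phi] this psi \<open>i \<le> n\<close>]
  have "(\<integral>\<omega>. \<phi> (X i \<omega>) * \<psi> (X (Suc n) \<omega>) + c * \<psi> (X (Suc n) \<omega>) \<partial>\<Omega>)
      = (\<integral>\<omega>. \<phi> (X i \<omega>) * markov_op K \<psi> (X n \<omega>) + c * markov_op K \<psi> (X n \<omega>) \<partial>\<Omega>)"
    by (simp add: distrib_right)
  moreover have "(\<integral>\<omega>. \<psi> (X (Suc n) \<omega>) \<partial>\<Omega>) = (\<integral>\<omega>. markov_op K \<psi> (X n \<omega>) \<partial>\<Omega>)"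
    using expectation_Suc_nonneg[OF one _ psi \<open>i \<le> n\<close>] by simp
  moreover note integrable_product[OF phi psi, of i "Suc n"]
    integrable_product[OF phi bounded_borel_markov_op[OF psi], of i n]
    O.integrable_bounded_borel_comp[OF X_measurable psi, of "Suc n"]
    O.integrable_bounded_borel_comp[OF X_measurable bounded_borel_markov_op[OF psi], of n]
  ultimately show ?thesis by simp
qed

text \<open>The latest step is removed first, turning \<open>\<psi>\<close> into
  \<open>markov_op K \<psi>\<close>, until both factors sit at time \<open>i\<close>.\<close>

lemma expectation_product:
  assumes phi: "bounded_borel c \<phi>" and psi: "bounded_borel d \<psi>"
  shows "(\<integral>\<omega>. \<phi> (X i \<omega>) * \<psi> (X (i + k) \<omega>) \<partial>\<Omega>)
    = (\<integral>\<omega>. \<phi> (X i \<omega>) * (markov_op K ^^ k) \<psi> (X i \<omega>) \<partial>\<Omega>)"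
  using psi
proof (induction k arbitrary: \<psi>)
  case (Suc k)
  have "(\<integral>\<omega>. \<phi> (X i \<omega>) * \<psi> (X (i + Suc k) \<omega>) \<partial>\<Omega>)
      = (\<integral>\<omega>. \<phi> (X i \<omega>) * markov_op K \<psi> (X (i + k) \<omega>) \<partial>\<Omega>)"
    using expectation_Suc[OF phi Suc.prems, of i "i + k"] by simp
  also have "\<dots> = (\<integral>\<omega>. \<phi> (X i \<omega>) * (markov_op K ^^ k) (markov_op K \<psi>) (X i \<omega>) \<partial>\<Omega>)"
    by (rule Suc.IH[OF bounded_borel_markov_op[OF Suc.prems]])
  finally show ?case by (simp add: funpow_swap1)
qed simp

end

section \<open>Geometric sums\<close>

text \<open>Distinct exponents pick distinct terms of the geometric series.\<close>

lemma sum_power_inj_le: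
  fixes b :: real
  assumes "finite S" "inj_on h S" "0 \<le> b" "b < 1"
  shows "(\<Sum>j\<in>S. b ^ h j) \<le> 1 / (1 - b)"
proof -
  have "(\<Sum>j\<in>S. b ^ h j) = (\<Sum>k\<in>h ` S. b ^ k)"
    using sum.reindex[OF assms(2), of "\<lambda>k. b ^ k"] by simp
  also have "\<dots> \<le> (\<Sum>k. b ^ k)"
    using assms by (intro sum_le_suminf summable_geometric) auto
  also have "\<dots> = 1 / (1 - b)"
    using assms by (intro suminf_geometric) auto
  finally show ?thesis .
qed

text \<open>Subtraction of naturals truncates at 0, so the exponent is the distance of
  \<open>i\<close> and \<open>j\<close>. On either side of \<open>i\<close> the exponents are
  distinct, and each side costs one geometric series.\<close>

lemma sum_power_distance_le:
  fixes b :: real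
  assumes b: "0 \<le> b" "b < 1"
  shows "(\<Sum>j=1..n. b ^ ((i - j) + (j - i))) \<le> 2 / (1 - b)"
proof -
  have "(\<Sum>j=1..n. b ^ ((i - j) + (j - i)))
      \<le> (\<Sum>j\<in>{1..n} \<inter> {..i}. b ^ (i - j)) + (\<Sum>j\<in>{1..n} - {..i}. b ^ (j - i))"
    by (subst sum.Int_Diff[of _ _ "{..i}"]) (auto intro!: add_mono sum_mono)
  also have "\<dots> \<le> 1 / (1 - b) + 1 / (1 - b)"
    by (intro add_mono sum_power_inj_le b) (auto simp: inj_on_def)
  finally show ?thesis by simp
qed

section \<open>The chain started from a bounded density\<close>

text \<open>Here \<open>q\<close> is a version of \<open>d\<nu>/d\<pi>\<close> whose bounds hold
  everywhere, \<open>D\<close> plays the role of the norm of \<open>d\<nu>/d\<pi> - 1\<close>, and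
  \<open>burn_in\<close> is the lower bound on \<open>n0\<close> with the logarithm removed.\<close>

locale markov_process_density =
  uniformly_ergodic_kernel K \<pi> \<alpha> M + markov_process K \<Omega> X
  for K :: "'a::metric_space \<Rightarrow> 'a measure" and \<pi> \<alpha> M and \<Omega> :: "'w measure" and X +
  fixes q :: "'a \<Rightarrow> real" and D :: real and n0 :: nat
  assumes q_measurable [measurable]: "q \<in> borel_measurable borel"
    and q_nonneg: "0 \<le> q x"
    and q_close: "\<bar>q x - 1\<bar> \<le> D"
    and distr_X0: "distr \<Omega> borel (X 0) = density \<pi> (\<lambda>x. ennreal (q x))"
    and burn_in: "2 * M * D * \<alpha> ^ n0 \<le> 1"
begin

lemma D_nonneg: "0 \<le> D"
  using q_close[of undefined] by linarith

lemma q_bounded: "bounded_borel (D + 1) q"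
  unfolding bounded_borel_def
proof (intro conjI allI)
  fix x show "\<bar>q x\<bar> \<le> D + 1" using q_close[of x] by linarith
qed simp

lemma q_minus_one_bounded: "bounded_borel D (\<lambda>x. q x - 1)"
  using q_close by (simp add: bounded_borel_def)

lemma distr_X: "distr \<Omega> borel (X m) = density \<pi> (\<lambda>x. ennreal ((P ^^ m) q x))"
proof (induction m)
  case (Suc m)
  then show ?case
    using bind_kernel_density[OF bounded_borel_markov_op_pow[OF q_bounded] markov_op_pow_nonneg[OF q_nonneg]]
    by (simp add: distr_Suc)
qed (simp add: distr_X0)

lemma integral_q: "(\<integral>x. q x \<partial>\<pi>) = 1"
proof -
  have "emeasure (density \<pi> (\<lambda>x. ennreal (q x))) UNIV = 1"
    using O.emeasure_space_1 by (simp add: distr_X0[symmetric] emeasure_distr)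
  then have "(\<integral>\<^sup>+x. ennreal (q x) \<partial>\<pi>) = 1"
    by (simp add: emeasure_density sets_pi)
  then show ?thesis
    using integrable_pi[OF q_bounded] q_nonneg by (simp add: nn_integral_eq_integral)
qed

text \<open>Convergence is applied to \<open>q - 1\<close>, which has mean 0 and bound
  \<open>D\<close>; by \<open>burn_in\<close> the deviation from 1 is at most 1. Time 0 is excluded
  because ergodicity speaks of positive times only; averages start at
  \<open>X (1 + n0)\<close>.\<close>

lemma density_le_2:
  assumes "1 \<le> m" "n0 \<le> m"
  shows "AE x in \<pi>. (P ^^ m) q x \<le> 2"
  using markov_op_pow_converges[OF q_minus_one_bounded]
proof eventually_elim
  case (elim x)
  have "(P ^^ m) (\<lambda>x. q x - 1) x = (P ^^ m) q x - 1"
    using markov_op_pow_add_const[OF q_bounded, of m "-1"] by simp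
  moreover have "(\<integral>x. q x - 1 \<partial>\<pi>) = 0"
    using integrable_pi[OF q_bounded] by (simp add: integral_q prob_space)
  ultimately have "\<bar>(P ^^ m) q x - 1\<bar> \<le> 2 * D * M * \<alpha> ^ m"
    using elim assms(1) by auto
  also have "\<dots> \<le> 2 * D * M * \<alpha> ^ n0"
    using D_nonneg M alpha assms(2) by (intro mult_left_mono power_decreasing) auto
  also have "\<dots> \<le> 1"
    using burn_in by (simp add: mult_ac)
  finally show ?case by linarith
qed

lemma nn_integral_X_le:
  assumes [measurable]: "g \<in> borel_measurable borel" and m: "1 \<le> m" "n0 \<le> m"
  shows "(\<integral>\<^sup>+\<omega>. g (X m \<omega>) \<partial>\<Omega>) \<le> 2 * (\<integral>\<^sup>+x. g x \<partial>\<pi>)"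
proof -
  have [measurable]: "(P ^^ m) q \<in> borel_measurable borel"
    by (rule bounded_borelD[OF bounded_borel_markov_op_pow[OF q_bounded]])
  have "(\<integral>\<^sup>+\<omega>. g (X m \<omega>) \<partial>\<Omega>) = (\<integral>\<^sup>+x. g x \<partial>distr \<Omega> borel (X m))"
    by (simp add: nn_integral_distr)
  also have "\<dots> = (\<integral>\<^sup>+x. ennreal ((P ^^ m) q x) * g x \<partial>\<pi>)"
    by (simp add: distr_X nn_integral_density)
  also have "\<dots> \<le> (\<integral>\<^sup>+x. 2 * g x \<partial>\<pi>)"
    using density_le_2[OF m]
    by (intro nn_integral_mono_AE, eventually_elim)
       (metis ennreal_leI ennreal_numeral mult_right_mono zero_le zero_le_numeral)
  also have "\<dots> = 2 * (\<integral>\<^sup>+x. g x \<partial>\<pi>)"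
    by (simp add: nn_integral_cmult measurable_pi)
  finally show ?thesis .
qed

text \<open>An upper bound on the density controls only nonnegative integrands, hence the absolute
  value on the right.\<close>

lemma expectation_X_le:
  assumes g: "bounded_borel c g" and m: "1 \<le> m" "n0 \<le> m"
  shows "(\<integral>\<omega>. g (X m \<omega>) \<partial>\<Omega>) \<le> 2 * (\<integral>x. \<bar>g x\<bar> \<partial>\<pi>)"
proof -
  have [measurable]: "g \<in> borel_measurable borel" by (rule bounded_borelD[OF g])
  have i: "integrable \<Omega> (\<lambda>\<omega>. g (X m \<omega>))"
    by (rule O.integrable_bounded_borel_comp[OF X_measurable g])
  have "ennreal (\<integral>\<omega>. \<bar>g (X m \<omega>)\<bar> \<partial>\<Omega>) \<le> 2 * ennreal (\<integral>x. \<bar>g x\<bar> \<partial>\<pi>)"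
    using nn_integral_X_le[OF _ m, of "\<lambda>x. ennreal \<bar>g x\<bar>"] i integrable_pi[OF g]
    by (simp add: nn_integral_eq_integral)
  also have "\<dots> = ennreal (2 * (\<integral>x. \<bar>g x\<bar> \<partial>\<pi>))"
    by (simp add: ennreal_mult)
  finally have "(\<integral>\<omega>. \<bar>g (X m \<omega>)\<bar> \<partial>\<Omega>) \<le> 2 * (\<integral>x. \<bar>g x\<bar> \<partial>\<pi>)"
    by (simp add: ennreal_le_iff)
  moreover have "(\<integral>\<omega>. g (X m \<omega>) \<partial>\<Omega>) \<le> (\<integral>\<omega>. \<bar>g (X m \<omega>)\<bar> \<partial>\<Omega>)"
    using i by (intro integral_mono) auto
  ultimately show ?thesis by linarith
qed

context
  fixes u c
  assumes u: "bounded_borel c u" and mean: "(\<integral>x. u x \<partial>\<pi>) = 0"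
begin

lemma expectation_product_le:
  assumes "1 \<le> i" "n0 \<le> i"
  shows "(\<integral>\<omega>. u (X i \<omega>) * u (X (i + k) \<omega>) \<partial>\<Omega>) \<le> 2 * (\<beta> ^ k * (\<integral>x. (u x)\<^sup>2 \<partial>\<pi>))"
proof -
  have "(\<integral>\<omega>. u (X i \<omega>) * u (X (i + k) \<omega>) \<partial>\<Omega>) = (\<integral>\<omega>. u (X i \<omega>) * (P ^^ k) u (X i \<omega>) \<partial>\<Omega>)"
    by (rule expectation_product[OF u u])
  also have "\<dots> \<le> 2 * (\<integral>x. \<bar>u x * (P ^^ k) u x\<bar> \<partial>\<pi>)"
    by (rule expectation_X_le[OF bounded_borel_mult[OF u bounded_borel_markov_op_pow[OF u]] assms])
  also have "\<dots> \<le> 2 * (\<beta> ^ k * (\<integral>x. (u x)\<^sup>2 \<partial>\<pi>))"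
    by (intro mult_left_mono correlation_le[OF u mean]) simp
  finally show ?thesis .
qed

lemma expectation_product_shift_le:
  assumes "1 \<le> i" "1 \<le> j"
  shows "(\<integral>\<omega>. u (X (i + n0) \<omega>) * u (X (j + n0) \<omega>) \<partial>\<Omega>)
    \<le> 2 * (\<beta> ^ ((i - j) + (j - i)) * (\<integral>x. (u x)\<^sup>2 \<partial>\<pi>))"
proof (cases "i \<le> j")
  case True
  then show ?thesis using expectation_product_le[of "i + n0" "j - i"] assms by (simp add: ac_simps)
next
  case False
  then show ?thesis using expectation_product_le[of "j + n0" "i - j"] assms by (simp add: ac_simps)
qed

text \<open>The factor 4 is 2 from the density bound times 2 from the two-sided geometric sum over
  each row of the double sum.\<close>

lemma second_moment_le:
  shows "(\<integral>\<omega>. (\<Sum>j=1..n. u (X (j + n0) \<omega>))\<^sup>2 \<partial>\<Omega>) \<le> 4 * real n / gap K \<pi> * (\<integral>x. (u x)\<^sup>2 \<partial>\<pi>)"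
proof -
  let ?V = "\<integral>x. (u x)\<^sup>2 \<partial>\<pi>"
  have "(\<integral>\<omega>. (\<Sum>j=1..n. u (X (j + n0) \<omega>))\<^sup>2 \<partial>\<Omega>)
      = (\<integral>\<omega>. (\<Sum>i=1..n. \<Sum>j=1..n. u (X (i + n0) \<omega>) * u (X (j + n0) \<omega>)) \<partial>\<Omega>)"
    by (simp add: power2_eq_square sum_product)
  also have "\<dots> = (\<Sum>i=1..n. \<Sum>j=1..n. \<integral>\<omega>. u (X (i + n0) \<omega>) * u (X (j + n0) \<omega>) \<partial>\<Omega>)"
    using integrable_product[OF u u] by simp
  also have "\<dots> \<le> (\<Sum>i=1..n. \<Sum>j=1..n. 2 * (\<beta> ^ ((i - j) + (j - i)) * ?V))"
    by (intro sum_mono expectation_product_shift_le) auto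
  also have "\<dots> = (\<Sum>i=1..n. 2 * ?V * (\<Sum>j=1..n. \<beta> ^ ((i - j) + (j - i))))"
    by (simp add: sum_distrib_left mult_ac)
  also have "\<dots> \<le> (\<Sum>i=1..n. 2 * ?V * (2 / (1 - \<beta>)))"
    by (intro sum_mono mult_left_mono sum_power_distance_le beta) simp
  also have "\<dots> = 4 * real n / gap K \<pi> * ?V"
    by (simp add: \<beta>_def)
  finally show ?thesis .
qed

lemma integrable_sum_power2: "integrable \<Omega> (\<lambda>\<omega>. (\<Sum>j=1..n. u (X (j + n0) \<omega>))\<^sup>2)"
  unfolding power2_eq_square sum_product
  by (intro Bochner_Integration.integrable_sum integrable_product[OF u u])

text \<open>A pointwise bound of \<open>v\<close> by \<open>l + v\<^sup>2 / (4 * l)\<close> makes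
  the estimate linear in the second moment; its 4 cancels the 4 in \<open>second_moment_le\<close>.
  The parameter \<open>l\<close> is left free for the truncation.\<close>

lemma nn_integral_avg_le:
  assumes n: "1 \<le> n" and l: "0 < l"
  shows "(\<integral>\<^sup>+\<omega>. ennreal \<bar>avg X n n0 u \<omega>\<bar> \<partial>\<Omega>)
    \<le> ennreal (l + (\<integral>x. (u x)\<^sup>2 \<partial>\<pi>) / (real n * gap K \<pi> * l))"
proof -
  let ?S = "\<lambda>\<omega>. \<Sum>j=1..n. u (X (j + n0) \<omega>)"
  let ?d = "4 * l * (real n)\<^sup>2"
  have gap: "0 < gap K \<pi>" using beta by (simp add: \<beta>_def)
  have "(\<integral>\<^sup>+\<omega>. ennreal \<bar>avg X n n0 u \<omega>\<bar> \<partial>\<Omega>) \<le> (\<integral>\<^sup>+\<omega>. ennreal (l + (?S \<omega>)\<^sup>2 / ?d) \<partial>\<Omega>)"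
  proof (intro nn_integral_mono ennreal_leI)
    fix \<omega>
    define v where "v = \<bar>avg X n n0 u \<omega>\<bar>"
    have "v\<^sup>2 = (?S \<omega>)\<^sup>2 / (real n)\<^sup>2"
      by (simp add: v_def avg_def power_divide)
    moreover have "v \<le> l + v\<^sup>2 / (4 * l)"
    proof -
      \<comment> \<open>The bound is this square expanded and divided by
        \<open>4 * l\<close>.\<close>
      have "0 \<le> (v - 2 * l)\<^sup>2" by simp
      then have "v * (4 * l) \<le> (l + v\<^sup>2 / (4 * l)) * (4 * l)"
        using l by (simp add: power2_eq_square algebra_simps)
      then show ?thesis by (rule mult_right_le_imp_le) (use l in simp)
    qed
    ultimately show "\<bar>avg X n n0 u \<omega>\<bar> \<le> l + (?S \<omega>)\<^sup>2 / ?d"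
      by (simp add: v_def mult.commute)
  qed
  also have "\<dots> = ennreal (\<integral>\<omega>. l + (?S \<omega>)\<^sup>2 / ?d \<partial>\<Omega>)"
    using l by (intro nn_integral_eq_integral Bochner_Integration.integrable_add
        integrable_divide integrable_sum_power2) auto
  also have "(\<integral>\<omega>. l + (?S \<omega>)\<^sup>2 / ?d \<partial>\<Omega>) = l + (\<integral>\<omega>. (?S \<omega>)\<^sup>2 \<partial>\<Omega>) / ?d"
  proof -
    have "integrable \<Omega> (\<lambda>\<omega>. (?S \<omega>)\<^sup>2 / ?d)"
      by (intro integrable_divide integrable_sum_power2)
    then show ?thesis by (simp add: O.prob_space)
  qed
  also have "\<dots> \<le> l + (4 * real n / gap K \<pi> * (\<integral>x. (u x)\<^sup>2 \<partial>\<pi>)) / ?d"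
    using l by (intro add_left_mono divide_right_mono second_moment_le) simp
  also have "\<dots> = l + (\<integral>x. (u x)\<^sup>2 \<partial>\<pi>) / (real n * gap K \<pi> * l)"
    using l n gap by (simp add: field_simps power2_eq_square)
  finally show ?thesis by (simp add: ennreal_leI)
qed

end

end

section \<open>The error bound\<close>

text \<open>Below the height \<open>t\<close> the spare factor is a power with exponent
  \<open>2 - p \<ge> 0\<close>, above it one with exponent \<open>1 - p \<le> 0\<close>; either is
  largest at \<open>t\<close>. The common right side lets both parts of \<open>f\<close> share one
  bound.\<close>

lemma truncation_le:
  fixes y t p :: real
  assumes "0 < t" "1 < p" "p \<le> 2" "0 \<le> y"
  shows "y \<le> t \<Longrightarrow> y\<^sup>2 / t \<le> t powr (1 - p) * y powr p"
    and "t < y \<Longrightarrow> y \<le> t powr (1 - p) * y powr p"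
proof -
  assume "y \<le> t"
  have "y\<^sup>2 = y powr (2 - p) * y powr p"
    using assms by (cases "y = 0") (auto simp flip: powr_add)
  also have "\<dots> \<le> t powr (2 - p) * y powr p"
    using assms \<open>y \<le> t\<close> by (intro mult_right_mono powr_mono2) auto
  also have "t powr (2 - p) = t powr (1 - p) * t"
    using assms powr_add[of t "1 - p" 1] by simp
  finally show "y\<^sup>2 / t \<le> t powr (1 - p) * y powr p"
    using assms by (simp add: pos_divide_le_eq mult_ac)
next
  assume "t < y"
  then have "y = y powr (1 - p) * y powr p"
    using assms by (simp flip: powr_add)
  also have "\<dots> \<le> t powr (1 - p) * y powr p"
    using assms \<open>t < y\<close> by (intro mult_right_mono powr_mono2') auto
  finally show "y \<le> t powr (1 - p) * y powr p" .
qed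

context markov_process_density
begin

text \<open>The bounded part \<open>f1\<close>, centred, is handled by second moments and costs
  \<open>t / N + A / t\<close> with \<open>N = real n * gap K \<pi>\<close>. The tail
  \<open>f2\<close> costs \<open>2 * B\<close> along the chain and \<open>B\<close> in the
  mean.\<close>

lemma abs_error_truncation_le:
  assumes [measurable]: "f \<in> borel_measurable borel"
    and fp: "integrable \<pi> (\<lambda>x. \<bar>f x\<bar> powr p)"
    and p: "1 < p" "p \<le> 2" and n: "1 \<le> n" and t: "0 < t"
  shows "abs_error \<Omega> X \<pi> n n0 f
    \<le> ennreal (t / (real n * gap K \<pi>) + 3 * (t powr (1 - p) * (\<integral>x. \<bar>f x\<bar> powr p \<partial>\<pi>)))"
proof -
  define f1 where "f1 x = (if \<bar>f x\<bar> \<le> t then f x else 0)" for x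
  define f2 where "f2 x = (if \<bar>f x\<bar> \<le> t then 0 else f x)" for x
  have f: "f x = f1 x + f2 x" for x by (simp add: f1_def f2_def)
  have [measurable]: "f1 \<in> borel_measurable borel" "f2 \<in> borel_measurable borel"
    unfolding f1_def[abs_def] f2_def[abs_def] by measurable
  have f1: "bounded_borel t f1"
    using t by (auto simp: bounded_borel_def f1_def)
  \<comment> \<open>At each point only one of the two summands is nonzero.\<close>
  have pointwise: "(f1 x)\<^sup>2 / t + \<bar>f2 x\<bar> \<le> t powr (1 - p) * \<bar>f x\<bar> powr p" for x
    using truncation_le[OF t p, of "\<bar>f x\<bar>"] by (auto simp: f1_def f2_def)
  have f2: "integrable \<pi> f2"
  proof (rule Bochner_Integration.integrable_bound)
    show "integrable \<pi> (\<lambda>x. t powr (1 - p) * \<bar>f x\<bar> powr p)" using fp by simp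
    have "\<bar>f2 x\<bar> \<le> t powr (1 - p) * \<bar>f x\<bar> powr p" for x
      using pointwise[of x] t zero_le_power2[of "f1 x"]
      by (smt (verit) divide_nonneg_pos)
    then show "AE x in \<pi>. norm (f2 x) \<le> norm (t powr (1 - p) * \<bar>f x\<bar> powr p)" by simp
  qed (simp add: measurable_pi)
  define m where "m = (\<integral>x. f1 x \<partial>\<pi>)"
  define u where "u x = f1 x - m" for x
  have u: "bounded_borel (t + \<bar>m\<bar>) u" and u_mean: "(\<integral>x. u x \<partial>\<pi>) = 0"
    using bounded_borel_centred[OF f1] integrable_pi[OF f1]
    by (auto simp: u_def[abs_def] m_def prob_space)
  define A where "A = (\<integral>x. (f1 x)\<^sup>2 \<partial>\<pi>)"
  define B where "B = (\<integral>x. \<bar>f2 x\<bar> \<partial>\<pi>)"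
  have A: "0 \<le> A" and B: "0 \<le> B" by (auto simp: A_def B_def)
  let ?N = "real n * gap K \<pi>"
  have gap: "0 < gap K \<pi>" using beta by (simp add: \<beta>_def)
  have N: "0 < ?N" using gap n by simp
  have AB: "A / t + B \<le> t powr (1 - p) * (\<integral>x. \<bar>f x\<bar> powr p \<partial>\<pi>)"
  proof -
    have "A / t + B = (\<integral>x. (f1 x)\<^sup>2 / t + \<bar>f2 x\<bar> \<partial>\<pi>)"
      using f2 integrable_pi_power2[OF f1] by (simp add: A_def B_def)
    also have "\<dots> \<le> (\<integral>x. t powr (1 - p) * \<bar>f x\<bar> powr p \<partial>\<pi>)"
      using f2 integrable_pi_power2[OF f1] fp pointwise by (intro integral_mono) auto
    finally show ?thesis by simp
  qed
  have mean: "(\<integral>x. f x \<partial>\<pi>) = m + (\<integral>x. f2 x \<partial>\<pi>)"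
    using f2 integrable_pi[OF f1] by (simp add: f m_def)
  have split: "\<bar>avg X n n0 f \<omega> - (\<integral>x. f x \<partial>\<pi>)\<bar>
      \<le> \<bar>avg X n n0 u \<omega>\<bar> + 1 / real n * (\<Sum>j=1..n. \<bar>f2 (X (j + n0) \<omega>)\<bar>) + B" for \<omega>
  proof -
    have "avg X n n0 f \<omega> = avg X n n0 u \<omega> + m + avg X n n0 f2 \<omega>"
      using n by (simp add: avg_def f u_def sum.distrib sum_subtractf field_simps)
    moreover have "\<bar>avg X n n0 f2 \<omega>\<bar> \<le> 1 / real n * (\<Sum>j=1..n. \<bar>f2 (X (j + n0) \<omega>)\<bar>)"
      unfolding avg_def abs_mult by (intro mult_mono) auto
    moreover have "\<bar>\<integral>x. f2 x \<partial>\<pi>\<bar> \<le> B"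
      unfolding B_def by (rule integral_abs_bound)
    ultimately show ?thesis using mean by linarith
  qed
  have [measurable]: "u \<in> borel_measurable borel" by (rule bounded_borelD[OF u])
  have [measurable]: "avg X n n0 u \<in> borel_measurable \<Omega>"
    unfolding avg_def[abs_def] by measurable
  have part1: "(\<integral>\<^sup>+\<omega>. ennreal \<bar>avg X n n0 u \<omega>\<bar> \<partial>\<Omega>) \<le> ennreal (t / ?N + A / t)"
  proof -
    have "(\<integral>\<^sup>+\<omega>. ennreal \<bar>avg X n n0 u \<omega>\<bar> \<partial>\<Omega>)
        \<le> ennreal (t / ?N + (\<integral>x. (u x)\<^sup>2 \<partial>\<pi>) / (?N * (t / ?N)))"
      using nn_integral_avg_le[OF u u_mean n, of "t / ?N"] t N by simp
    also have "?N * (t / ?N) = t"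
      using gap n by simp
    also have "t / ?N + (\<integral>x. (u x)\<^sup>2 \<partial>\<pi>) / t \<le> t / ?N + A / t"
      unfolding A_def u_def m_def using t
      by (intro add_left_mono divide_right_mono integral_centred_power2_le[OF f1]) auto
    finally show ?thesis by (simp add: ennreal_leI)
  qed
  have part2: "(\<integral>\<^sup>+\<omega>. ennreal (1 / real n * (\<Sum>j=1..n. \<bar>f2 (X (j + n0) \<omega>)\<bar>)) \<partial>\<Omega>) \<le> ennreal (2 * B)"
  proof -
    have "(\<integral>\<^sup>+\<omega>. ennreal (1 / real n * (\<Sum>j=1..n. \<bar>f2 (X (j + n0) \<omega>)\<bar>)) \<partial>\<Omega>)
        = ennreal (1 / real n) * (\<Sum>j=1..n. \<integral>\<^sup>+\<omega>. ennreal \<bar>f2 (X (j + n0) \<omega>)\<bar> \<partial>\<Omega>)"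
    proof -
      have "ennreal (1 / real n * (\<Sum>j=1..n. \<bar>f2 (X (j + n0) \<omega>)\<bar>))
          = ennreal (1 / real n) * (\<Sum>j=1..n. ennreal \<bar>f2 (X (j + n0) \<omega>)\<bar>)" for \<omega>
        by (subst ennreal_mult) (auto simp: sum_nonneg)
      then show ?thesis
        by (simp only:) (subst nn_integral_cmult, measurable, subst nn_integral_sum, auto)
    qed
    also have "\<dots> \<le> ennreal (1 / real n) * (\<Sum>j=1..n. ennreal (2 * B))"
    proof (intro mult_left_mono sum_mono)
      fix j assume "j \<in> {1..n}"
      then have "(\<integral>\<^sup>+\<omega>. ennreal \<bar>f2 (X (j + n0) \<omega>)\<bar> \<partial>\<Omega>) \<le> 2 * (\<integral>\<^sup>+x. ennreal \<bar>f2 x\<bar> \<partial>\<pi>)"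
        by (intro nn_integral_X_le) auto
      also have "(\<integral>\<^sup>+x. ennreal \<bar>f2 x\<bar> \<partial>\<pi>) = ennreal B"
        unfolding B_def using f2 by (intro nn_integral_eq_integral) auto
      finally show "(\<integral>\<^sup>+\<omega>. ennreal \<bar>f2 (X (j + n0) \<omega>)\<bar> \<partial>\<Omega>) \<le> ennreal (2 * B)"
        using B by (simp add: ennreal_mult)
    qed simp
    also have "\<dots> = ennreal (1 / real n) * ennreal (real n * (2 * B))"
      using B by (simp add: ennreal_mult ennreal_of_nat_eq_real_of_nat)
    also have "\<dots> = ennreal (1 / real n * (real n * (2 * B)))"
      using B by (intro ennreal_mult[symmetric]) auto
    also have "1 / real n * (real n * (2 * B)) = 2 * B"
      using n by simp
    finally show ?thesis .
  qed
  have "abs_error \<Omega> X \<pi> n n0 f \<le> (\<integral>\<^sup>+\<omega>. ennreal \<bar>avg X n n0 u \<omega>\<bar>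
      + ennreal (1 / real n * (\<Sum>j=1..n. \<bar>f2 (X (j + n0) \<omega>)\<bar>)) + ennreal B \<partial>\<Omega>)"
    unfolding abs_error_def
  proof (intro nn_integral_mono)
    fix \<omega>
    have "0 \<le> 1 / real n * (\<Sum>j=1..n. \<bar>f2 (X (j + n0) \<omega>)\<bar>)"
      by (intro mult_nonneg_nonneg sum_nonneg) auto
    then have "ennreal \<bar>avg X n n0 u \<omega>\<bar> + ennreal (1 / real n * (\<Sum>j=1..n. \<bar>f2 (X (j + n0) \<omega>)\<bar>)) + ennreal B
        = ennreal (\<bar>avg X n n0 u \<omega>\<bar> + 1 / real n * (\<Sum>j=1..n. \<bar>f2 (X (j + n0) \<omega>)\<bar>) + B)"
      using B by simp
    then show "ennreal \<bar>avg X n n0 f \<omega> - (\<integral>x. f x \<partial>\<pi>)\<bar> \<le> ennreal \<bar>avg X n n0 u \<omega>\<bar>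
        + ennreal (1 / real n * (\<Sum>j=1..n. \<bar>f2 (X (j + n0) \<omega>)\<bar>)) + ennreal B"
      using ennreal_leI[OF split[of \<omega>]] by simp
  qed
  also have "\<dots> = (\<integral>\<^sup>+\<omega>. ennreal \<bar>avg X n n0 u \<omega>\<bar> \<partial>\<Omega>)
      + (\<integral>\<^sup>+\<omega>. ennreal (1 / real n * (\<Sum>j=1..n. \<bar>f2 (X (j + n0) \<omega>)\<bar>)) \<partial>\<Omega>) + ennreal B"
    by (subst nn_integral_add, measurable, subst nn_integral_add, measurable)
       (simp add: O.emeasure_space_1)
  also have "\<dots> \<le> ennreal (t / ?N + A / t) + ennreal (2 * B) + ennreal B"
    by (intro add_mono part1 part2) simp
  also have "\<dots> = ennreal (t / ?N + A / t + 2 * B + B)"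
    using A B t N by (simp del: mult_2 mult_2_right flip: ennreal_plus)
  also have "\<dots> \<le> ennreal (t / ?N + 3 * (t powr (1 - p) * (\<integral>x. \<bar>f x\<bar> powr p \<partial>\<pi>)))"
  proof (rule ennreal_leI)
    \<comment> \<open>Nonnegativity of \<open>A / t\<close> gives
      \<open>A / t + 3 * B \<le> 3 * (A / t + B)\<close>, to which \<open>AB\<close>
      applies.\<close>
    have "0 \<le> A / t" using A t by simp
    then show "t / ?N + A / t + 2 * B + B \<le> t / ?N + 3 * (t powr (1 - p) * (\<integral>x. \<bar>f x\<bar> powr p \<partial>\<pi>))"
      using AB by linarith
  qed
  finally show ?thesis .
qed

text \<open>With \<open>t powr p = F * N\<close> the term \<open>t powr (1 - p) * F\<close> equals
  \<open>t / N\<close>, so the truncation bound is \<open>4 * t / N\<close>.\<close>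

lemma abs_error_le:
  assumes f: "f \<in> Lp_space \<pi> p" and p: "1 < p" "p \<le> 2" and n: "1 \<le> n"
  shows "abs_error \<Omega> X \<pi> n n0 f
    \<le> ennreal (4 * Lp_norm \<pi> p f / (real n * gap K \<pi>) powr (1 - 1 / p))"
proof -
  define F where "F = (\<integral>x. \<bar>f x\<bar> powr p \<partial>\<pi>)"
  define N where "N = real n * gap K \<pi>"
  have N: "0 < N" using n beta by (simp add: N_def \<beta>_def)
  have F: "0 \<le> F" by (simp add: F_def)
  have bound: "abs_error \<Omega> X \<pi> n n0 f \<le> ennreal (t / N + 3 * (t powr (1 - p) * F))" if "0 < t" for t
    unfolding F_def N_def using f p n that sets_pi
    by (intro abs_error_truncation_le) (auto simp: Lp_space_def cong: measurable_cong_sets)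
  show ?thesis
  proof (cases "F = 0")
    case True
    \<comment> \<open>For \<open>F = 0\<close> that choice of \<open>t\<close> would be 0; instead
      \<open>t = e * N\<close> with arbitrary \<open>e > 0\<close> shows that the error
      vanishes.\<close>
    have "abs_error \<Omega> X \<pi> n n0 f \<le> 0"
    proof (rule ennreal_le_epsilon)
      fix e :: real assume "0 < e"
      then show "abs_error \<Omega> X \<pi> n n0 f \<le> 0 + ennreal e"
        using bound[of "e * N"] N True by simp
    qed
    then show ?thesis by simp
  next
    case False
    then have F: "0 < F" using F by simp
    define t where "t = (F * N) powr (1 / p)"
    have t: "0 < t" using F N by (simp add: t_def)
    have tp: "t powr p = F * N" using F N p by (simp add: t_def powr_powr)
    have "t powr (1 - p) * F = t / N"
      using t N F by (simp add: powr_diff tp field_simps)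
    moreover have "t / N = F powr (1 / p) / N powr (1 - 1 / p)"
      using F N by (simp add: t_def powr_mult powr_diff)
    ultimately show ?thesis
      using bound[OF t] by (simp add: Lp_norm_def F_def N_def)
  qed
qed

end

section \<open>The burn-in condition and the version of the density\<close>

text \<open>From \<open>\<alpha> \<le> exp (\<alpha> - 1)\<close> the power
  \<open>\<alpha> ^ n0\<close> is at most \<open>exp (- (n0 * (1 - \<alpha>)))\<close>; this also
  covers \<open>\<alpha> = 0\<close>, as no logarithm of \<open>\<alpha>\<close> occurs.\<close>

lemma burn_in_le:
  fixes \<alpha> M D :: real
  assumes "0 \<le> \<alpha>" "\<alpha> < 1" "0 < M" "0 \<le> D"
    and n0: "D \<noteq> 0 \<Longrightarrow> real n0 \<ge> ln (2 * M * D) / (1 - \<alpha>)"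
  shows "2 * M * D * \<alpha> ^ n0 \<le> 1"
proof (cases "D = 0")
  case False
  then have D: "0 < 2 * M * D" using assms by simp
  have "\<alpha> ^ n0 \<le> exp (\<alpha> - 1) ^ n0"
    using assms exp_ge_add_one_self[of "\<alpha> - 1"] by (intro power_mono) auto
  also have "\<dots> = exp (- (real n0 * (1 - \<alpha>)))"
    by (simp add: algebra_simps flip: exp_of_nat_mult)
  also have "\<dots> \<le> exp (- ln (2 * M * D))"
    using n0[OF False] assms by (simp add: pos_divide_le_eq)
  also have "\<dots> = 1 / (2 * M * D)"
    using D by (simp add: exp_minus inverse_eq_divide)
  finally show ?thesis
    using D by (simp add: pos_le_divide_eq mult.commute)
qed simp

lemma Linf_norm_AE:
  assumes "prob_space \<pi>" "f \<in> borel_measurable \<pi>" "AE x in \<pi>. \<bar>f x\<bar> \<le> c"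
  obtains D where "Linf_norm \<pi> f = ereal D" "0 \<le> D" "AE x in \<pi>. \<bar>f x\<bar> \<le> D"
proof -
  interpret prob_space \<pi> by fact
  have [measurable]: "f \<in> borel_measurable \<pi>" by fact
  have ae: "AE x in \<pi>. ereal \<bar>f x\<bar> \<le> Linf_norm \<pi> f"
    unfolding Linf_norm_def by (rule esssup_AE)
  then have "AE x in \<pi>. 0 \<le> Linf_norm \<pi> f"
    by eventually_elim (metis abs_ge_zero ereal_less_eq(5) order_trans)
  \<comment> \<open>The claim does not depend on \<open>x\<close>, and a probability measure is not
    the zero measure.\<close>
  then have "0 \<le> Linf_norm \<pi> f" by simp
  moreover have "Linf_norm \<pi> f \<le> ereal c"
    unfolding Linf_norm_def using assms(3) by (intro esssup_I) auto
  ultimately obtain D where "Linf_norm \<pi> f = ereal D" "0 \<le> D"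
    by (cases "Linf_norm \<pi> f") auto
  with ae that show ?thesis by auto
qed

theorem theorem1:
  fixes \<pi> \<nu> :: "'a::metric_space measure"
    and K :: "'a \<Rightarrow> 'a measure"
    and \<Omega> :: "'w measure"
    and X :: "nat \<Rightarrow> 'w \<Rightarrow> 'a"
    and \<alpha> M p :: real
    and n0 n :: nat
    and f :: "'a \<Rightarrow> real"
  assumes "prob_space \<pi>" and "sets \<pi> = sets borel"
    and "prob_space \<nu>" and "sets \<nu> = sets borel"
    and "transition_kernel K"
    and "stationary K \<pi>"
    and "markov_chain \<Omega> X K \<nu>"
    and "reversible K \<pi>"
    and "uniformly_ergodic K \<pi> \<alpha> M"
    and "density \<pi> (RN_deriv \<pi> \<nu>) = \<nu>"
    and "Linf_norm \<pi> (real_dens \<pi> \<nu>) < \<infinity>"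
    and "1 < p" and "p \<le> 2"
    \<comment> \<open>the guard encodes the convention \<open>log 0 = -\<infinity>\<close>\<close>
    and "Linf_norm \<pi> (\<lambda>x. real_dens \<pi> \<nu> x - 1) \<noteq> 0 \<Longrightarrow>
           real n0 \<ge> ln (2 * M * real_of_ereal (Linf_norm \<pi> (\<lambda>x. real_dens \<pi> \<nu> x - 1))) / (1 - \<alpha>)"
    and "1 \<le> n"
    and "f \<in> Lp_space \<pi> p"
  shows "abs_error \<Omega> X \<pi> n n0 f \<le>
           ennreal (4 * Lp_norm \<pi> p f / (real n * gap K \<pi>) powr (1 - 1 / p)
                  + 4 * Lp_norm \<pi> p f / (real n * (1 - \<alpha>)) powr (2 - 2 / p))"
proof -
  interpret pi: prob_space \<pi> by fact
  interpret nu: prob_space \<nu> by fact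
  have [measurable]: "real_dens \<pi> \<nu> \<in> borel_measurable \<pi>"
    unfolding real_dens_def[abs_def] by measurable
  then have dens_borel [measurable]: "real_dens \<pi> \<nu> \<in> borel_measurable borel"
    using assms(2) by (simp cong: measurable_cong_sets)
  have dens: "AE x in \<pi>. RN_deriv \<pi> \<nu> x = ennreal (real_dens \<pi> \<nu> x)"
  proof -
    \<comment> \<open>The derivative integrates to the total mass 1 of \<open>\<nu>\<close>, so it
      is finite almost everywhere and agrees there with its real version.\<close>
    have "(\<integral>\<^sup>+x. RN_deriv \<pi> \<nu> x \<partial>\<pi>) = emeasure (density \<pi> (RN_deriv \<pi> \<nu>)) (space \<pi>)"
      by (simp add: emeasure_density cong: nn_integral_cong)
    also have "\<dots> = 1"
      using nu.emeasure_space_1 assms(10) by (metis space_density)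
    finally have "AE x in \<pi>. RN_deriv \<pi> \<nu> x \<noteq> \<infinity>"
      by (intro nn_integral_PInf_AE) auto
    then show ?thesis
      by eventually_elim (simp add: real_dens_def less_top)
  qed
  obtain c where "AE x in \<pi>. \<bar>real_dens \<pi> \<nu> x\<bar> \<le> c"
  proof (cases "Linf_norm \<pi> (real_dens \<pi> \<nu>)")
    case (real c)
    have "AE x in \<pi>. ereal \<bar>real_dens \<pi> \<nu> x\<bar> \<le> Linf_norm \<pi> (real_dens \<pi> \<nu>)"
      unfolding Linf_norm_def by (rule esssup_AE)
    with real that show ?thesis by auto
  next
    case MInf
    have "AE x in \<pi>. ereal \<bar>real_dens \<pi> \<nu> x\<bar> \<le> Linf_norm \<pi> (real_dens \<pi> \<nu>)"
      unfolding Linf_norm_def by (rule esssup_AE)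
    with MInf that show ?thesis by auto
  qed (use assms(11) in auto)
  then have "AE x in \<pi>. \<bar>real_dens \<pi> \<nu> x - 1\<bar> \<le> c + 1"
    by eventually_elim linarith
  then obtain D where D: "Linf_norm \<pi> (\<lambda>x. real_dens \<pi> \<nu> x - 1) = ereal D" "0 \<le> D"
      "AE x in \<pi>. \<bar>real_dens \<pi> \<nu> x - 1\<bar> \<le> D"
    by (rule Linf_norm_AE[OF assms(1), rotated]) auto
  \<comment> \<open>a version of the density within distance \<open>D\<close> of \<open>1\<close> everywhere, not just almost everywhere\<close>
  define q where "q x = (if \<bar>real_dens \<pi> \<nu> x - 1\<bar> \<le> D then real_dens \<pi> \<nu> x else 1)" for x
  have q_meas: "q \<in> borel_measurable borel"
    unfolding q_def[abs_def] by measurable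
  have "density \<pi> (\<lambda>x. ennreal (q x)) = density \<pi> (RN_deriv \<pi> \<nu>)"
  proof (rule density_cong)
    show "(\<lambda>x. ennreal (q x)) \<in> borel_measurable \<pi>"
      using q_meas assms(2) by (simp cong: measurable_cong_sets)
    show "AE x in \<pi>. ennreal (q x) = RN_deriv \<pi> \<nu> x"
      using dens D(3) by eventually_elim (simp add: q_def)
  qed simp
  then have nu: "\<nu> = density \<pi> (\<lambda>x. ennreal (q x))"
    using assms(10) by simp
  have chain: "prob_space \<Omega>" "\<And>n. X n \<in> \<Omega> \<rightarrow>\<^sub>M borel" "distr \<Omega> borel (X 0) = \<nu>"
    using assms(7) by (auto simp: markov_chain_def)
  have erg: "0 \<le> \<alpha>" "\<alpha> < 1" "0 < M"
    using assms(9) by (auto simp: uniformly_ergodic_def)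
  interpret O: prob_space \<Omega> by fact
  interpret markov_process_density K \<pi> \<alpha> M \<Omega> X q D n0
  proof unfold_locales
    \<comment> \<open>Since the norm is \<open>ereal D\<close>, the guard of the hypothesis on
      \<open>n0\<close> reads \<open>D \<noteq> 0\<close>.\<close>
    show "2 * M * D * \<alpha> ^ n0 \<le> 1"
      using assms(14) D erg by (intro burn_in_le) auto
    show "\<bar>q x - 1\<bar> \<le> D" "0 \<le> q x" for x
      using D(2) by (auto simp: q_def real_dens_def)
    show "distr \<Omega> borel (X 0) = density \<pi> (\<lambda>x. ennreal (q x))"
      using chain(3) nu by simp
    show "AE \<omega> in \<Omega>. real_cond_exp \<Omega> (past_algebra \<Omega> X n) (\<lambda>\<omega>'. indicator A (X (Suc n) \<omega>')) \<omega>
        = measure (K (X n \<omega>)) A" if "A \<in> sets borel" for A n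
      using assms(7) that by (simp add: markov_chain_def)
  qed (use assms chain q_meas in auto)
  have "abs_error \<Omega> X \<pi> n n0 f \<le> ennreal (4 * Lp_norm \<pi> p f / (real n * gap K \<pi>) powr (1 - 1 / p))"
    using assms by (intro abs_error_le) auto
  \<comment> \<open>The second summand is nonnegative.\<close>
  also have "\<dots> \<le> ennreal (4 * Lp_norm \<pi> p f / (real n * gap K \<pi>) powr (1 - 1 / p)
      + 4 * Lp_norm \<pi> p f / (real n * (1 - \<alpha>)) powr (2 - 2 / p))"
    by (intro ennreal_leI) (simp add: Lp_norm_def)
  finally show ?thesis .
qed

end
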